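(* Let $G$ be a finite simple graph that is cubic (i.e. $3$-regular) and claw-free. Then $\gamma_g(G) \le \frac{n(G)}{2}$.
   Context: All graphs are finite, simple and undirected (and non-empty); $n(G)$ is the number of vertices of $G$. Graphs need not be connected. A graph is claw-free if it has no induced subgraph isomorphic to the star $K_{1,3}$. The closed neighborhood of $v$ is $N_G[v]=N_G(v)\cup\{v\}$, and a vertex $v$ dominates exactly the vertices of $N_G[v]$. Domination game: two players, Dominator and Staller, alternately select vertices of $G$; a selected vertex must dominate at least one vertex not dominated by the previously selected vertices, i.e. selecting $v$ is legal if and only if $N_G[v]\not\subseteq \bigcup_{u\in D}N_G[u]$, where $D$ is the set of previously selected vertices. The game ends when no legal move exists (equivalently, when the selected vertices form a dominating set). Dominator wants to minimize the total number of moves, Staller wants to maximize it. The game domination number $\gamma_g(G)$ is the total number of moves (of both players) when Dominator moves first and both players play optimally. *)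

theory Defs
  imports "Graph_Theory.Graph_Theory"
begin

text \<open>
  Following \<^theory>\<open>Graph_Theory.Digraph\<close>, a finite simple undirected graph is a finite symmetric
  digraph without loops and parallel arcs (locale \<^locale>\<open>graph\<close>): an edge \<open>uv\<close> is the pair of arcs
  from \<open>u\<close> to \<open>v\<close> and from \<open>v\<close> to \<open>u\<close>. In such a graph the out-degree of a vertex is its number of
  neighbours, i.e. its degree in the undirected sense.
\<close>

definition cubic :: "('a, 'b) pre_digraph \<Rightarrow> bool" where
  "cubic G \<longleftrightarrow> (\<forall>v \<in> verts G. out_degree G v = 3)"

definition claw_free :: "('a, 'b) pre_digraph \<Rightarrow> bool" where
  "claw_free G \<longleftrightarrow> \<not> (\<exists>H. induced_subgraph H G \<and> K\<^bsub>1,3\<^esub> H)"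

definition closed_neighborhood :: "('a, 'b) pre_digraph \<Rightarrow> 'a \<Rightarrow> 'a set" where
  "closed_neighborhood G v = {u. v \<rightarrow>\<^bsub>G\<^esub> u} \<union> {v}"

definition legal_moves :: "('a, 'b) pre_digraph \<Rightarrow> 'a set \<Rightarrow> 'a set" where
  "legal_moves G D =
     {v \<in> verts G. \<not> closed_neighborhood G v \<subseteq> (\<Union>u \<in> D. closed_neighborhood G u)}"

datatype player = Dominator | Staller

text \<open>
  \<open>moves_left G p D\<close> is the number of moves still to be made under optimal play when \<open>D\<close> is the set
  of vertices selected so far and it is the turn of \<open>p\<close>. The value 0 on infinite graphs is a dummy
  that makes the recursion terminate; a legal move is never in \<open>D\<close>, so on finite graphs the number
  of unselected vertices decreases.
\<close>

function moves_left :: "('a, 'b) pre_digraph \<Rightarrow> player \<Rightarrow> 'a set \<Rightarrow> nat" where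
  "moves_left G Dominator D =
     (if infinite (verts G) \<or> legal_moves G D = {} then 0
      else 1 + (MIN v \<in> legal_moves G D. moves_left G Staller (insert v D)))"
| "moves_left G Staller D =
     (if infinite (verts G) \<or> legal_moves G D = {} then 0
      else 1 + (MAX v \<in> legal_moves G D. moves_left G Dominator (insert v D)))"
  by pat_completeness auto
termination
proof -
  have "card (verts G - insert v D) < card (verts G - D)"
    if "finite (verts G)" "v \<in> legal_moves G D" for G :: "('a, 'b) pre_digraph" and v D
    using that by (intro psubset_card_mono) (auto simp: legal_moves_def)
  then show ?thesis
    by (relation "measure (\<lambda>(G, p, D). card (verts G - D))") auto
qed

declare moves_left.simps [simp del]

definition game_domination_number :: "('a, 'b) pre_digraph \<Rightarrow> nat" ("\<gamma>\<^sub>g") where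
  "\<gamma>\<^sub>g G = moves_left G Dominator {}"

end

theory Submission
  imports Defs
begin

text \<open>
  Call the undominated vertices white. A white vertex with 0, 1, 2, 3 white neighbours gets weight
  12, 9, 7, 6. The total weight is \<open>6 n\<close> at the start and at least 12 while the game lasts, so it
  suffices that Dominator can always move in such a way that his move and any reply of Staller
  together lower the weight by at least 24.

  A reply lowers the weight by at least 6, except that dominating only an ear (a white vertex whose
  white neighbours are exactly two adjacent vertices) lowers it by 3, 4 or 5. A move of Dominator
  worth at least 21 is therefore always sufficient; otherwise he needs a move worth at least 18 that
  creates few ears. Such a move is found by looking at a white triangle. If there is none, then the
  components of the white graph are paths and cycles, and only the case of isolated vertices and
  cycles of length at least 4 requires a finer count.
\<close>

section \<open>The weight of a position\<close>

text \<open>The consecutive differences 3, 2, 1 of the weights mean that a white vertex of white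
  degree k that loses one white neighbour gets heavier by 4 - k. The last weight 6 is also the
  budget per vertex: at 24 per round, that is 12 per move, a total of 6 n pays for n/2 moves.

  The obstacle is the ear. Dominating only its tip is worth k + l - 1, where k and l are the white
  degrees of the other two triangle vertices, so such a reply can miss the required 6 by up to 3.
  The case distinction is ordered to control this loss. Positions that already contain an ear come
  first, because the triangle at an ear is itself profitable for Dominator. In a position without
  ears, the tip of an ear created by a move had white degree 3 before and is next to a vertex
  removed by the move; hence only few vertices have to be inspected, and none once all white degrees
  are at most two.

  Claw-freeness acts on both sides: it makes two white neighbours of a dominated vertex adjacent,
  which limits Staller's cheap replies, and it forces a triangle at every vertex of white degree
  three, which gives Dominator his profit.\<close>

text \<open>
  The values 12, 9, 7 are determined by rounds played on disjoint copies of a white vertex, a white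
  edge or a white triangle: Dominator removes such a component as a whole, Staller only one vertex
  of it, and the two moves together have to be worth 24.
\<close>
definition wt :: "nat \<Rightarrow> int" where
  "wt k = (if k = 0 then 12 else if k = 1 then 9 else if k = 2 then 7 else 6)"

lemma wt_simps [simp]: "wt 0 = 12" "wt (Suc 0) = 9" "wt 1 = 9" "wt 2 = 7" "wt 3 = 6"
  by (simp_all add: wt_def)

lemma wt_ge_6: "wt k \<ge> 6"
  by (simp add: wt_def)

text \<open>The largest step is \<open>wt 0 - wt 1 = 3\<close>, and for \<open>d\<close> at least 2
  the whole range 12 - 6 of the weights already suffices. Truncated subtraction is harmless, since
  weights never exceed 12.\<close>

lemma wt_diff_le: "wt (k - d) - wt k \<le> 3 * int d"
proof -
  consider "d = 0" | "d = 1" | "d \<ge> 2" by linarith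
  then show ?thesis
  proof cases
    case 2
    then show ?thesis by (auto simp: wt_def)
  qed (auto simp: wt_def)
qed

section \<open>Claw-free cubic graphs given by their neighbourhoods\<close>

locale claw_free_cubic_nbs =
  fixes V :: "'a set" and nb :: "'a \<Rightarrow> 'a set"
  assumes fin: "finite V"
    and nb_V: "u \<in> nb v \<Longrightarrow> u \<in> V"
    and nb_sym: "u \<in> nb v \<Longrightarrow> v \<in> nb u"
    and nb_irrefl: "v \<notin> nb v"
    and card_nb: "v \<in> V \<Longrightarrow> card (nb v) = 3"
    and no_claw: "\<lbrakk>a \<in> nb x; b \<in> nb x; c \<in> nb x; a \<noteq> b; a \<noteq> c; b \<noteq> c\<rbrakk>
      \<Longrightarrow> a \<in> nb b \<or> a \<in> nb c \<or> b \<in> nb c"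
begin

definition N :: "'a \<Rightarrow> 'a set" where
  "N v = insert v (nb v)"

text \<open>
  The only trace of the earlier moves that matters: every dominated vertex is dominated
    by a selected
  vertex, whose closed neighbourhood contains no white vertex.
\<close>
definition reach :: "'a set \<Rightarrow> bool" where
  "reach U \<longleftrightarrow> U \<subseteq> V \<and> (\<forall>v \<in> V - U. \<exists>u \<in> V. v \<in> N u \<and> N u \<inter> U = {})"

definition white_deg :: "'a set \<Rightarrow> 'a \<Rightarrow> nat" where
  "white_deg U x = card (nb x \<inter> U)"

definition Phi :: "'a set \<Rightarrow> int" where
  "Phi U = (\<Sum>x\<in>U. wt (white_deg U x))"

definition dec :: "'a set \<Rightarrow> 'a \<Rightarrow> int" where
  "dec U v = Phi U - Phi (U - N v)"

text \<open>The additional weight of a survivor \<open>y\<close> when \<open>A\<close> turns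
  dominated. The value 0 outside \<open>U\<close> allows sums over vertices whose colour is not
  known.\<close>

definition inc :: "'a set \<Rightarrow> 'a set \<Rightarrow> 'a \<Rightarrow> int" where
  "inc U A y = (if y \<in> U then wt (white_deg U y - card (nb y \<inter> A)) - wt (white_deg U y) else 0)"

definition ear :: "'a set \<Rightarrow> 'a \<Rightarrow> 'a \<Rightarrow> 'a \<Rightarrow> bool" where
  "ear U x y z \<longleftrightarrow> x \<in> U \<and> y \<noteq> z \<and> nb x \<inter> U = {y, z} \<and> y \<in> nb z"

lemma nb_iff: "u \<in> nb v \<longleftrightarrow> v \<in> nb u"
  using nb_sym by blast

lemma finite_nb [simp]: "finite (nb v)"
  using fin nb_V by (meson finite_subset subsetI)

lemma nbE1:
  assumes "p \<in> nb x"
  obtains q r where "nb x = {p, q, r}" "p \<noteq> q" "p \<noteq> r" "q \<noteq> r"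
proof -
  have "x \<in> V" using assms nb_sym nb_V by blast
  then have "card (nb x - {p}) = 2" using assms card_nb by simp
  then obtain q r where "nb x - {p} = {q, r}" "q \<noteq> r" by (auto simp: card_2_iff)
  then show ?thesis using that[of q r] assms by blast
qed

lemma nbE2:
  assumes "p \<in> nb x" "q \<in> nb x" "p \<noteq> q"
  obtains r where "nb x = {p, q, r}" "p \<noteq> r" "q \<noteq> r"
proof -
  obtain s t where st: "nb x = {p, s, t}" "p \<noteq> s" "p \<noteq> t" "s \<noteq> t" using assms(1) by (rule nbE1)
  then consider "q = s" | "q = t" using assms by auto
  then show ?thesis
  proof cases
    case 1
    then show ?thesis using st that[of t] by simp
  next
    case 2
    then show ?thesis using st that[of s] by (simp add: insert_commute)
  qed
qed

lemma white_deg_eq: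
  assumes "nb x = {p, q, r}" "p \<noteq> q" "p \<noteq> r" "q \<noteq> r"
  shows "white_deg U x = of_bool (p \<in> U) + of_bool (q \<in> U) + of_bool (r \<in> U)"
  unfolding white_deg_def assms(1) using assms(2-) by (simp add: Int_insert_left)

lemma white_deg_le_3: "x \<in> V \<Longrightarrow> white_deg U x \<le> 3"
  using card_nb[of x] by (simp add: white_deg_def) (metis card_mono finite_nb inf_le1)

lemma white_deg_pos: "y \<in> nb x \<Longrightarrow> y \<in> U \<Longrightarrow> white_deg U x \<ge> 1"
  unfolding white_deg_def
    by (metis IntI One_nat_def Suc_leI card_gt_0_iff emptyE finite_Int finite_nb)

section \<open>How much weight a move removes\<close>

lemma reach_diff:
  assumes "reach U" "v \<in> V"
  shows "reach (U - N v)"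
proof -
  have "\<exists>u \<in> V. x \<in> N u \<and> N u \<inter> (U - N v) = {}" if "x \<in> V - (U - N v)" for x
  proof (cases "x \<in> N v")
    case True
    then show ?thesis using assms(2) by blast
  next
    case False
    then have "x \<in> V - U" using that by blast
    then show ?thesis using assms(1) unfolding reach_def by blast
  qed
  then show ?thesis using assms(1) unfolding reach_def by blast
qed

text \<open>The vertices of \<open>A\<close> give up their weight, and only survivors next to
  \<open>A\<close> get heavier. Besides these, \<open>C\<close> may contain dominated vertices, so
  an application can list all outer neighbours without a case distinction on their colour.\<close>

lemma dec_eq:
  assumes "U \<subseteq> V" and A: "N v \<inter> U = A" and "finite C" "C \<inter> A = {}"
    and C: "\<And>x. x \<in> A \<Longrightarrow> nb x \<inter> U \<subseteq> A \<union> C"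
  shows "dec U v = (\<Sum>x\<in>A. wt (white_deg U x)) - (\<Sum>y\<in>C. inc U A y)"
proof -
  have finU: "finite U" using assms(1) fin finite_subset by blast
  have AU: "A \<subseteq> U" using A by blast
  have k': "white_deg (U - A) y = white_deg U y - card (nb y \<inter> A)" for y
  proof -
    have "nb y \<inter> (U - A) = nb y \<inter> U - nb y \<inter> A" by blast
    moreover have "nb y \<inter> A \<subseteq> nb y \<inter> U" using AU by blast
    ultimately show ?thesis unfolding white_deg_def by (simp add: card_Diff_subset)
  qed
  have 1: "Phi U = (\<Sum>x\<in>A. wt (white_deg U x)) + (\<Sum>x\<in>U - A. wt (white_deg U x))"
    unfolding Phi_def using sum.subset_diff[OF AU finU] by (simp add: add.commute)
  have "(\<Sum>x\<in>U - A. wt (white_deg (U - A) x)) - (\<Sum>x\<in>U - A. wt (white_deg U x)) = (\<Sum>y\<in>U - A. inc U A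
    y)"
    unfolding sum_subtractf[symmetric] by (intro sum.cong) (auto simp: k' inc_def)
  also have "\<dots> = (\<Sum>y\<in>C \<inter> U. inc U A y)"
  proof (rule sum.mono_neutral_right)
    show "\<forall>y\<in>U - A - C \<inter> U. inc U A y = 0"
    proof
      fix y assume "y \<in> U - A - C \<inter> U"
      then have "nb y \<inter> A = {}" using C nb_sym by blast
      then show "inc U A y = 0" by (simp add: inc_def)
    qed
  qed (use finU assms(4) in auto)
  also have "\<dots> = (\<Sum>y\<in>C. inc U A y)"
    using \<open>finite C\<close> by (intro sum.mono_neutral_left) (auto simp: inc_def)
  finally have "(\<Sum>x\<in>U - A. wt (white_deg (U - A) x)) - (\<Sum>x\<in>U - A. wt (white_deg U x)) = (\<Sum>y\<in>C. inc U
    A y)" .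
  moreover have "U - N v = U - A" using A by blast
  ultimately show ?thesis unfolding dec_def 1 by (simp add: Phi_def)
qed

text \<open>Double counting of the edges between \<open>A\<close> and \<open>U - A\<close>: by
  \<open>wt_diff_le\<close> each costs at most 3. Charging them to their ends in \<open>A\<close>
  makes the bound a sum of local terms.\<close>

lemma dec_lower:
  assumes "U \<subseteq> V" and A: "N v \<inter> U = A"
  shows "dec U v \<ge> (\<Sum>x\<in>A. wt (white_deg U x) - 3 * int (card (nb x \<inter> (U - A))))"
proof -
  have finA: "finite A" using A by (auto simp: N_def)
  have finU: "finite U" using assms(1) fin finite_subset by blast
  have eq: "dec U v = (\<Sum>x\<in>A. wt (white_deg U x)) - (\<Sum>y\<in>U - A. inc U A y)"
    using assms finU by (intro dec_eq) auto
  have card: "card (nb y \<inter> A) = (\<Sum>x\<in>A. of_bool (y \<in> nb x))" for y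
  proof -
    have "nb y \<inter> A = {x \<in> A. y \<in> nb x}" using nb_iff by blast
    then show ?thesis using finA by (simp add: Int_def)
  qed
  have "(\<Sum>y\<in>U - A. inc U A y) \<le> (\<Sum>y\<in>U - A. 3 * int (card (nb y \<inter> A)))"
    by (intro sum_mono) (use wt_diff_le in \<open>auto simp: inc_def\<close>)
  also have "\<dots> = 3 * (\<Sum>y\<in>U - A. \<Sum>x\<in>A. of_bool (y \<in> nb x))"
    by (simp add: sum_distrib_left card)
  also have "\<dots> = 3 * (\<Sum>x\<in>A. \<Sum>y\<in>U - A. of_bool (y \<in> nb x))"
    by (subst sum.swap) simp
  also have "\<dots> = (\<Sum>x\<in>A. 3 * int (card (nb x \<inter> (U - A))))"
    using finU by (simp add: sum_distrib_left Int_commute Int_def conj_commute)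
  finally show ?thesis unfolding eq sum_subtractf by linarith
qed

section \<open>Staller's moves\<close>

text \<open>A vertex with a white neighbour cannot be the one whose selection dominated
  \<open>w\<close>; so \<open>w\<close> was dominated by a neighbour and not by itself.\<close>

lemma dominated_witness:
  assumes "reach U" "w \<in> V" "w \<notin> U" "x \<in> nb w" "x \<in> U"
  obtains u where "u \<in> nb w" "u \<notin> U" "nb u \<inter> U = {}"
proof -
  obtain u where u: "w \<in> N u" "N u \<inter> U = {}" using assms unfolding reach_def by blast
  have "u \<noteq> w" using u assms by (auto simp: N_def)
  then show ?thesis using u that[of u] nb_iff by (auto simp: N_def)
qed

text \<open>The witness \<open>u\<close> has no white neighbour, so only the edge between
  \<open>x\<close> and \<open>y\<close> can prevent a claw at \<open>w\<close> with leaves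
  \<open>x\<close>, \<open>y\<close>, \<open>u\<close>.\<close>

lemma dominated_adj:
  assumes "reach U" "w \<in> V" "w \<notin> U" "x \<in> nb w" "x \<in> U" "y \<in> nb w" "y \<in> U" "x \<noteq> y"
  shows "x \<in> nb y"
proof -
  obtain u where u: "u \<in> nb w" "u \<notin> U" "nb u \<inter> U = {}"
    using dominated_witness[OF assms(1-5)] .
  then have "x \<in> nb y \<or> x \<in> nb u \<or> y \<in> nb u" using no_claw[of x w y u] assms by blast
  then show ?thesis using u assms by blast
qed

lemma white_deg_le_2:
  assumes "x \<in> V" "b \<in> nb x" "b \<notin> U"
  shows "white_deg U x \<le> 2"
proof -
  have "white_deg U x \<le> card (nb x - {b})"
    unfolding white_deg_def by (rule card_mono) (use assms(3) in auto)
  then show ?thesis using assms card_nb[of x] by simp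
qed

lemma dominated_k:
  assumes "reach U" "w \<in> V" "w \<notin> U"
  shows "white_deg U w \<le> 2"
proof (cases "nb w \<inter> U = {}")
  case False
  then obtain x where "x \<in> nb w" "x \<in> U" by blast
  then obtain u where u: "u \<in> nb w" "u \<notin> U" using dominated_witness[OF assms] by metis
  then show ?thesis using white_deg_le_2 assms(2) by blast
qed (simp add: white_deg_def)

lemma white_deg_2E:
  assumes "white_deg U x = 2"
  obtains y z where "nb x \<inter> U = {y, z}" "y \<noteq> z"
  using assms unfolding white_deg_def by (metis card_2_iff)

lemma white_deg_1E:
  assumes "white_deg U x = 1"
  obtains y where "nb x \<inter> U = {y}"
  using assms unfolding white_deg_def by (metis card_1_singletonE)

lemma card_outside:
  assumes "w \<in> nb x" "w \<in> A" "A \<subseteq> U"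
  shows "Suc (card (nb x \<inter> (U - A))) \<le> white_deg U x"
proof -
  have "card (insert w (nb x \<inter> (U - A))) \<le> card (nb x \<inter> U)"
    by (rule card_mono) (use assms in auto)
  then show ?thesis using assms unfolding white_deg_def by simp
qed

text \<open>The edge to \<open>w\<close> stays inside \<open>A\<close>, so at most
  \<open>white_deg U x - 1\<close> edges are charged. For white degrees 1, 2, 3 this leaves 9, 7 - 3
  = 4 and 6 - 6 = 0.\<close>

lemma wt_partner:
  assumes "w \<in> nb x" "w \<in> A" "A \<subseteq> U" "x \<in> V"
  shows "wt (white_deg U x) - 3 * int (card (nb x \<inter> (U - A))) \<ge> (if white_deg U x \<le> 2 then 4 else
    0)"
  using card_outside[OF assms(1-3)] white_deg_le_3[OF assms(4), of U] by (auto simp: wt_def)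

lemma dec_undominated:
  assumes "U \<subseteq> V" "w \<in> U"
  shows "dec U w \<ge> wt (white_deg U w) + (\<Sum>x\<in>nb w \<inter> U. if white_deg U x \<le> 2 then 4 else 0)"
proof -
  define A where "A = N w \<inter> U"
  have A: "A = insert w (nb w \<inter> U)" "w \<notin> nb w \<inter> U"
    unfolding A_def using assms nb_irrefl by (auto simp: N_def)
  have "nb w \<inter> (U - A) = {}" using A by auto
  then have "(\<Sum>x\<in>A. wt (white_deg U x) - 3 * int (card (nb x \<inter> (U - A))))
      = wt (white_deg U w) + (\<Sum>x\<in>nb w \<inter> U. wt (white_deg U x) - 3 * int (card (nb x \<inter> (U - A))))"
    using A by simp
  moreover have "(\<Sum>x\<in>nb w \<inter> U. (if white_deg U x \<le> 2 then 4 else 0) :: int)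
      \<le> (\<Sum>x\<in>nb w \<inter> U. wt (white_deg U x) - 3 * int (card (nb x \<inter> (U - A))))"
    by (rule sum_mono, rule wt_partner[of w]) (use A assms nb_iff in auto)
  ultimately show ?thesis using dec_lower[OF assms(1) A_def[symmetric]] by simp
qed

lemma dec_single:
  assumes "U \<subseteq> V" "N w \<inter> U = {x}"
  shows "dec U w = wt (white_deg U x) - (\<Sum>y\<in>nb x \<inter> U. wt (white_deg U y - 1) - wt (white_deg U y))"
proof -
  have "nb y \<inter> {x} = {x}" if "y \<in> nb x" for y using that nb_sym by blast
  then have "(\<Sum>y\<in>nb x \<inter> U. inc U {x} y) = (\<Sum>y\<in>nb x \<inter> U. wt (white_deg U y - 1) - wt (white_deg U
    y))"
    by (intro sum.cong) (auto simp: inc_def)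
  moreover have "dec U w = (\<Sum>x\<in>{x}. wt (white_deg U x)) - (\<Sum>y\<in>nb x \<inter> U. inc U {x} y)"
    by (rule dec_eq[OF assms]) (use nb_irrefl in auto)
  ultimately show ?thesis by simp
qed

lemma ear_k:
  assumes "U \<subseteq> V" "ear U x y z"
  shows "white_deg U x = 2" "white_deg U y \<in> {2, 3}" "white_deg U z \<in> {2, 3}" "x \<in> U" "y \<in> U"
    "z \<in> U"
    "y \<in> nb x" "z \<in> nb x" "y \<in> nb z" "y \<noteq> z" "x \<noteq> y" "x \<noteq> z"
proof -
  have e: "nb x \<inter> U = {y, z}" "y \<noteq> z" "x \<in> U" "y \<in> nb z" using assms(2) unfolding ear_def by auto
  then show yz: "x \<in> U" "y \<in> U" "z \<in> U" "y \<in> nb x" "z \<in> nb x" "y \<in> nb z" "y \<noteq> z" "x \<noteq> y" "x \<noteq> z"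
    using nb_irrefl by auto
  show "white_deg U x = 2" using e by (simp add: white_deg_def)
  have "{x, z} \<subseteq> nb y \<inter> U" "{x, y} \<subseteq> nb z \<inter> U" using yz nb_iff by auto
  then have "card {x, z} \<le> white_deg U y" "card {x, y} \<le> white_deg U z" unfolding white_deg_def
    by (meson card_mono finite_Int finite_nb)+
  then have "2 \<le> white_deg U y" "2 \<le> white_deg U z" using yz by auto
  moreover have "white_deg U y \<le> 3" "white_deg U z \<le> 3" using white_deg_le_3 yz assms(1) by auto
  ultimately show "white_deg U y \<in> {2, 3}" "white_deg U z \<in> {2, 3}" by auto
qed

text \<open>A white \<open>w\<close> secures at least its own weight, since its neighbours pay for
  the edges charged to them. A dominated \<open>w\<close> has at most two white neighbours; two of
  them are adjacent, have white degree at most 2 and give 4 each. Only a single white neighbour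
  \<open>x\<close> leads to the last two cases, whose values are exact: 9 - (4 - k) for a leaf and 7
  - (4 - k) - (4 - l) for an ear.\<close>

lemma staller_bound:
  assumes "reach U" "w \<in> V" "N w \<inter> U \<noteq> {}"
  obtains (large) "dec U w \<ge> 8"
  | (centre) "dec U w \<ge> 6" "w \<in> U" "white_deg U w = 3"
  | (leaf) x y where "x \<in> U" "nb x \<inter> U = {y}" "dec U w = 5 + int (white_deg U y)"
  | (ear) x y z where "ear U x y z" "dec U w = int (white_deg U y) + int (white_deg U z) - 1"
proof (cases "w \<in> U")
  case True
  have UV: "U \<subseteq> V" using assms(1) by (simp add: reach_def)
  have lb: "dec U w \<ge> wt (white_deg U w) + (\<Sum>x\<in>nb w \<inter> U. if white_deg U x \<le> 2 then 4 else 0)"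
    using dec_undominated[OF UV True] .
  have nn: "(\<Sum>x\<in>nb w \<inter> U. (if white_deg U x \<le> 2 then 4 else 0) :: int) \<ge> 0"
    by (rule sum_nonneg) auto
  consider "white_deg U w = 3" | "white_deg U w = 2" | "white_deg U w = 1" | "white_deg U w = 0"
    using white_deg_le_3[OF assms(2), of U] by linarith
  then show ?thesis
  proof cases
    case 1
    then show ?thesis using lb nn True centre by simp
  next
    case 2
    then obtain y z where yz: "nb w \<inter> U = {y, z}" "y \<noteq> z" by (rule white_deg_2E)
    define A where "A = {w, y, z}"
    have A: "N w \<inter> U = A" using yz True by (auto simp: N_def A_def)
    have w: "w \<noteq> y" "w \<noteq> z" "y \<in> V" "z \<in> V" using yz nb_irrefl UV by auto
    have out: "nb w \<inter> (U - A) = {}" using yz A_def by auto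
    have *: "wt (white_deg U x) - 3 * int (card (nb x \<inter> (U - A))) \<ge> (if white_deg U x \<le> 2 then 4
      else 0)"
      if "x \<in> {y, z}" for x
      by (rule wt_partner[of w]) (use yz A w nb_iff that in \<open>auto simp: A_def\<close>)
    have y: "wt (white_deg U y) - 3 * int (card (nb y \<inter> (U - A))) \<ge> 0"
      and z: "wt (white_deg U z) - 3 * int (card (nb z \<inter> (U - A))) \<ge> 0"
      using *[of y] *[of z] by (auto split: if_splits)
    have z': "wt (white_deg U x) - 3 * int (card (nb x \<inter> (U - A))) \<ge> 4" if "white_deg U x \<le> 2"
      "x \<in> {y, z}" for x
      using *[of x] that by auto
    have "y \<in> nb w" "z \<in> nb w" using yz by auto
    then obtain b where b: "nb w = {y, z, b}" "y \<noteq> b" "z \<noteq> b" using yz(2) by (rule nbE2)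
    have bU: "b \<notin> U" using yz b by auto
    have "dec U w \<ge> 7 + (wt (white_deg U y) - 3 * int (card (nb y \<inter> (U - A)))) + (wt (white_deg U z)
      - 3 * int (card (nb z \<inter> (U - A))))"
      using dec_lower[OF UV A] out 2 w yz(2) unfolding A_def by simp
    \<comment> \<open>The weight 7 of \<open>w\<close> is one short of 8. If \<open>y\<close> and
      \<open>z\<close> are adjacent, at most one edge at \<open>y\<close> leaves \<open>A\<close>.
      Otherwise claw-freeness at \<open>w\<close> makes \<open>y\<close> or \<open>z\<close>
      adjacent to the dominated \<open>b\<close>, which lowers its white degree to at most
      2.\<close>
    moreover have "wt (white_deg U y) - 3 * int (card (nb y \<inter> (U - A))) \<ge> 1 \<or> wt (white_deg U z) - 3
      * int (card (nb z \<inter> (U - A))) \<ge> 1"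
    proof (cases "y \<in> nb z")
      case True
      have "nb y \<inter> (U - A) \<subseteq> nb y - {w, z}" unfolding A_def by auto
      then have "card (nb y \<inter> (U - A)) \<le> card (nb y - {w, z})" by (simp add: card_mono)
      also have "\<dots> = 1"
      proof -
        have "{w, z} \<subseteq> nb y" using True yz nb_iff by blast
        then show ?thesis using w card_nb[of y] by (simp add: card_Diff_subset)
      qed
      finally show ?thesis using wt_ge_6[of "white_deg U y"] by linarith
    next
      case False
      then have "y \<in> nb b \<or> z \<in> nb b" using no_claw[of y w z b] b yz by auto
      then have "white_deg U y \<le> 2 \<or> white_deg U z \<le> 2"
      proof
        assume "y \<in> nb b"
        then show ?thesis using white_deg_le_2[of y b U] w bU nb_iff by blast
      next
        assume "z \<in> nb b"
        then show ?thesis using white_deg_le_2[of z b U] w bU nb_iff by blast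
      qed
      then show ?thesis using z'[of y] z'[of z] by auto
    qed
    ultimately show ?thesis using y z large by linarith
  qed (use lb nn large in simp_all)
next
  case False
  have UV: "U \<subseteq> V" using assms(1) by (simp add: reach_def)
  have A: "N w \<inter> U = nb w \<inter> U" using False by (auto simp: N_def)
  have "white_deg U w \<le> 2" by (rule dominated_k[OF assms(1,2) False])
  moreover have "white_deg U w \<noteq> 0" using assms(3) A by (simp add: white_deg_def)
  ultimately consider "white_deg U w = 2" | "white_deg U w = 1" by linarith
  then show ?thesis
  proof cases
    case 1
    then obtain x y where xy: "nb w \<inter> U = {x, y}" "x \<noteq> y" by (rule white_deg_2E)
    have adj: "x \<in> nb y" using dominated_adj[OF assms(1,2) False] xy by blast
    have k: "white_deg U u \<le> 2" if "u \<in> {x, y}" for u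
    proof -
      have "u \<in> nb w \<inter> U" using that unfolding xy(1) .
      then have "u \<in> V" "w \<in> nb u" using UV nb_sym by auto
      then show ?thesis using white_deg_le_2 False by blast
    qed
    have "wt (white_deg U u) - 3 * int (card (nb u \<inter> (U - {x, y}))) \<ge> 4" if u: "u \<in> {x, y}" for u
    proof -
      obtain u' where u': "u' \<in> nb u" "u' \<in> {x, y}" using u adj nb_sym[OF adj] by blast
      moreover have "{x, y} \<subseteq> U" using xy by auto
      moreover have "u \<in> V" using u \<open>{x, y} \<subseteq> U\<close> UV by auto
      ultimately show ?thesis using wt_partner[of u' u "{x, y}" U] k[OF u] by simp
    qed
    moreover define f where "f u = wt (white_deg U u) - 3 * int (card (nb u \<inter> (U - {x, y})))" for u
    ultimately have "f x \<ge> 4" "f y \<ge> 4" by auto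
    then have "(\<Sum>u\<in>{x, y}. f u) \<ge> 8" using xy(2) by simp
    then show ?thesis using dec_lower[OF UV, of w "{x, y}"] A xy large unfolding f_def by simp
  next
    case 2
    then obtain x where x: "nb w \<inter> U = {x}" by (rule white_deg_1E)
    then have xU: "x \<in> U" "x \<in> V" "w \<in> nb x" using UV nb_iff by auto
    have d: "dec U w = wt (white_deg U x) - (\<Sum>y\<in>nb x \<inter> U. wt (white_deg U y - 1) - wt (white_deg U
      y))"
      using dec_single[OF UV] A x by simp
    have "white_deg U x \<le> 2" using white_deg_le_2[of x w U] xU False by blast
    then consider "white_deg U x = 0" | "white_deg U x = 1" | "white_deg U x = 2" by linarith
    then show ?thesis
    proof cases
      case 1
      then show ?thesis using d large by (simp add: white_deg_def)
    next
      case 2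
      then obtain y where y: "nb x \<inter> U = {y}" by (rule white_deg_1E)
      have "white_deg U y \<ge> 1" using white_deg_pos[of x y U] y xU nb_iff by blast
      moreover have "white_deg U y \<le> 3" using white_deg_le_3 y UV by blast
      ultimately have "dec U w = 5 + int (white_deg U y)" using d 2 y by (auto simp: wt_def)
      then show ?thesis using leaf[of x y] xU y by simp
    next
      case 3
      then obtain y z where yz: "nb x \<inter> U = {y, z}" "y \<noteq> z" by (rule white_deg_2E)
      then have yz': "y \<in> nb x" "y \<in> U" "z \<in> nb x" "z \<in> U" by auto
      then have "y \<noteq> x" "z \<noteq> x" using nb_irrefl by metis+
      then have "y \<notin> nb w" "z \<notin> nb w" using x yz' by auto
      \<comment> \<open>As \<open>x\<close> is the only white neighbour of \<open>w\<close>, a claw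
        at \<open>x\<close> with leaves \<open>y\<close>, \<open>z\<close>, \<open>w\<close> is
        prevented only by the edge between \<open>y\<close> and \<open>z\<close>.\<close>
      then have "y \<in> nb z"
        using no_claw[of y x z w] yz' yz(2) xU False nb_sym[of w y] nb_sym[of w z] by metis
      then have ear': "ear U x y z" using xU yz by (simp add: ear_def)
      have "dec U w = int (white_deg U y) + int (white_deg U z) - 1"
        using d 3 yz ear_k(2,3)[OF UV ear'] by (auto simp: wt_def)
      then show ?thesis using ear ear' by blast
    qed
  qed
qed

section \<open>Positions with an ear\<close>

text \<open>If Staller has no reply, the condition on \<open>w\<close> is vacuous; the single last
  move is then paid for by \<open>Phi_ge_12\<close>.\<close>

definition pair_saving :: "'a set \<Rightarrow> bool" where
  "pair_saving U \<longleftrightarrow> (\<exists>v \<in> V. N v \<inter> U \<noteq> {} \<and>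
    (\<forall>w \<in> V. N w \<inter> (U - N v) \<noteq> {} \<longrightarrow> dec U v + dec (U - N v) w \<ge> 24))"

lemma inc_outside: "y \<notin> U \<Longrightarrow> inc U A y = 0"
  by (simp add: inc_def)

lemma inc_single:
  assumes "y \<in> U" "U \<subseteq> V" "nb y \<inter> A = {x}" "A \<subseteq> U"
  shows "inc U A y = 4 - int (white_deg U y)" "white_deg U y \<ge> 1" "white_deg U y \<le> 3"
proof -
  show "white_deg U y \<ge> 1" using white_deg_pos[of x y U] assms by blast
  moreover show "white_deg U y \<le> 3" using white_deg_le_3 assms by blast
  ultimately show "inc U A y = 4 - int (white_deg U y)" using assms by (auto simp: inc_def wt_def)
qed

lemma inc_single_le:
  assumes "U \<subseteq> V" "y \<in> U \<Longrightarrow> nb y \<inter> A = {x}" "A \<subseteq> U"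
  shows "inc U A y \<le> 3"
  using inc_single[of y U A x] inc_outside[of y U A] assms by fastforce

lemma white_deg_ge_2:
  assumes "p \<in> nb x" "q \<in> nb x" "p \<noteq> q" "p \<in> U" "q \<in> U"
  shows "white_deg U x \<ge> 2"
proof -
  have "card {p, q} \<le> white_deg U x" unfolding white_deg_def by (rule card_mono) (use assms in auto)
  then show ?thesis using assms by simp
qed

lemma inc_double:
  assumes "y \<in> U" "U \<subseteq> V" "nb y \<inter> A = {x, x'}" "x \<noteq> x'" "A \<subseteq> U"
  shows "inc U A y = (if white_deg U y = 2 then 5 else 3)" "white_deg U y \<ge> 2" "white_deg U y \<le> 3"
proof -
  show "white_deg U y \<ge> 2" using white_deg_ge_2[of x y x' U] assms by blast
  moreover show "white_deg U y \<le> 3" using white_deg_le_3 assms by blast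
  ultimately have "white_deg U y = 2 \<or> white_deg U y = 3" by linarith
  then show "inc U A y = (if white_deg U y = 2 then 5 else 3)" using assms by (auto simp: inc_def)
qed

lemma nb_Int_insert:
  "nb y \<inter> insert a A = (if y \<in> nb a then insert a (nb y \<inter> A) else nb y \<inter> A)"
  using nb_iff[of y a] by auto

text \<open>By \<open>staller_bound\<close> every reply except an ear move is worth at least 6,
  whence 18 = 24 - 6. An ear move is worth one less than the sum of the two white degrees, whence 25
  = 24 + 1.\<close>

lemma pair_savingI:
  assumes "reach U" "v \<in> V" "N v \<inter> U \<noteq> {}" and d: "dec U v \<ge> 18"
    and e: "\<And>x y z. ear (U - N v) x y z \<Longrightarrow>
      dec U v + int (white_deg (U - N v) y) + int (white_deg (U - N v) z) \<ge> 25"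
  shows "pair_saving U"
  unfolding pair_saving_def
proof (intro bexI conjI ballI impI)
  fix w assume w: "w \<in> V" "N w \<inter> (U - N v) \<noteq> {}"
  have r: "reach (U - N v)" using assms reach_diff by blast
  then have UV: "U - N v \<subseteq> V" by (simp add: reach_def)
  show "dec U v + dec (U - N v) w \<ge> 24"
  proof (rule staller_bound[OF r w])
    fix x y assume xy: "x \<in> U - N v" "nb x \<inter> (U - N v) = {y}"
      "dec (U - N v) w = 5 + int (white_deg (U - N v) y)"
    then have "x \<in> nb y" using nb_iff[of x y] by blast
    then have "white_deg (U - N v) y \<ge> 1" using white_deg_pos xy(1) by blast
    then show ?thesis using xy d by linarith
  next
    fix x y z assume "ear (U - N v) x y z"
      "dec (U - N v) w = int (white_deg (U - N v) y) + int (white_deg (U - N v) z) - 1"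
    then show ?thesis using e[of x y z] by linarith
  qed (use d in linarith)+
qed (use assms in auto)

text \<open>Both base vertices of an ear have white degree at least 2, and 21 + 2 + 2 = 25.\<close>

lemma pair_savingI21:
  assumes "reach U" "v \<in> U" "dec U v \<ge> 21"
  shows "pair_saving U"
proof (rule pair_savingI)
  have UV: "U \<subseteq> V" using assms(1) by (simp add: reach_def)
  then show "v \<in> V" "N v \<inter> U \<noteq> {}" using assms by (auto simp: N_def)
  show "dec U v + int (white_deg (U - N v) y) + int (white_deg (U - N v) z) \<ge> 25"
    if "ear (U - N v) x y z" for x y z
    using ear_k(2,3)[OF _ that] UV assms(3) by force
qed (use assms in auto)

text \<open>The neighbours of \<open>v\<close> are used up, so claw-freeness at \<open>c\<close>
  leaves only the edge between \<open>c1\<close> and \<open>c2\<close>: an outer neighbour of a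
  triangle lies in a triangle of its own.\<close>

lemma outer_adj:
  assumes "nb v = {a, b, c}" "a \<notin> nb c" "b \<notin> nb c" "c \<noteq> a" "c \<noteq> b"
  obtains c1 c2 where "nb c = {v, c1, c2}" "v \<noteq> c1" "v \<noteq> c2" "c1 \<noteq> c2" "c1 \<in> nb c2" "c2 \<in> nb c1"
    "c1 \<noteq> c" "c2 \<noteq> c"
proof -
  have "c \<in> nb v" using assms(1) by simp
  then have vc: "v \<in> nb c" by (rule nb_sym)
  then obtain c1 c2 where c: "nb c = {v, c1, c2}" "v \<noteq> c1" "v \<noteq> c2" "c1 \<noteq> c2" by (rule nbE1)
  have ne: "c1 \<noteq> c" "c2 \<noteq> c" using c nb_irrefl[of c] by auto
  have nv: "c1 \<notin> nb v" "c2 \<notin> nb v" using c assms ne by auto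
  have "c1 \<in> nb c2 \<or> c1 \<in> nb v \<or> c2 \<in> nb v" using no_claw[of c1 c c2 v] c by auto
  then have "c1 \<in> nb c2" using nv by blast
  then show ?thesis using that[of c1 c2] c ne nb_sym by blast
qed

text \<open>Here \<open>net\<close> is what an outer neighbour \<open>c\<close> contributes when it
  is removed together with \<open>y\<close>. White degree 2 gives at least 7 - 3. For white degree 3
  the survivors \<open>c1\<close> and \<open>c2\<close> are white and adjacent, so each has white
  degree at least 2 and gets heavier by at most 2; one of white degree 3 gets heavier by only
  1.\<close>

lemma outer_net:
  assumes "U \<subseteq> V" "A \<subseteq> U" "nb c = {y, c1, c2}" "y \<noteq> c1" "y \<noteq> c2" "c1 \<noteq> c2" "c1 \<in> nb c2"
    and "y \<in> U" "c \<in> U" "c1 \<in> U \<Longrightarrow> nb c1 \<inter> A = {c}" "c2 \<in> U \<Longrightarrow> nb c2 \<inter> A = {c}"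
    and "net = wt (white_deg U c) - inc U A c1 - inc U A c2"
  shows "white_deg U c = 1 \<Longrightarrow> net = 9" "white_deg U c = 2 \<Longrightarrow> net \<ge> 4"
    "white_deg U c = 3 \<Longrightarrow> net \<ge> 2"
      "white_deg U c = 3 \<Longrightarrow> white_deg U c1 = 2 \<and> white_deg U c2 = 2 \<or> net \<ge> 3" "net \<ge> 2"
    "1 \<le> white_deg U c" "white_deg U c \<le> 3"
proof -
  have k: "white_deg U c = 1 + of_bool (c1 \<in> U) + of_bool (c2 \<in> U)"
    using white_deg_eq[OF assms(3-6), of U] assms(8) by simp
  show k1: "1 \<le> white_deg U c" "white_deg U c \<le> 3" using k by auto
  have i: "inc U A c1 \<le> 3" "inc U A c2 \<le> 3" using inc_single_le assms by blast+
  show 1: "net = 9" if "white_deg U c = 1" using that k assms(12)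
    by (auto simp: inc_outside split: if_splits)
  show 2: "net \<ge> 4" if "white_deg U c = 2"
  proof -
    have "c1 \<notin> U \<or> c2 \<notin> U" using that k by auto
    then show ?thesis using that i assms(12) inc_outside[of c1 U A] inc_outside[of c2 U A] by auto
  qed
  have 3: "net \<ge> 2 \<and> (white_deg U c1 = 2 \<and> white_deg U c2 = 2 \<or> net \<ge> 3)" if "white_deg U c = 3"
  proof -
    have U: "c1 \<in> U" "c2 \<in> U" using that k by (auto simp: of_bool_def split: if_splits)
    have "c \<in> nb c1" "c \<in> nb c2" using assms(3) nb_iff by auto
    moreover have "c2 \<in> nb c1" using assms(7) nb_sym by blast
    moreover have "c \<noteq> c1" "c \<noteq> c2" using assms(3) nb_irrefl[of c] by auto
    ultimately have "white_deg U c1 \<ge> 2" "white_deg U c2 \<ge> 2"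
      using white_deg_ge_2[of c c1 c2 U] white_deg_ge_2[of c c2 c1 U] U assms by auto
    moreover have "inc U A c1 = 4 - int (white_deg U c1)" "inc U A c2 = 4 - int (white_deg U c2)"
      using inc_single(1) assms U by blast+
    ultimately show ?thesis using that assms(12) by auto
  qed
  then show "white_deg U c = 3 \<Longrightarrow> net \<ge> 2"
    "white_deg U c = 3 \<Longrightarrow> white_deg U c1 = 2 \<and> white_deg U c2 = 2 \<or> net \<ge> 3" by auto
  have "white_deg U c = 1 \<or> white_deg U c = 2 \<or> white_deg U c = 3" using k1 by linarith
  then show "net \<ge> 2" using 1 2 3 by auto
qed

text \<open>The triangle is a whole white component, worth 3 * 7 = 21.\<close>

lemma ear_22:
  assumes "reach U" "ear U v y z" "white_deg U y = 2" "white_deg U z = 2"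
  shows "pair_saving U"
proof -
  have UV: "U \<subseteq> V" using assms(1) by (simp add: reach_def)
  note e = ear_k[OF UV assms(2)]
  have v: "nb v \<inter> U = {y, z}" using assms(2) by (simp add: ear_def)
  obtain c where c: "nb y = {v, z, c}" "v \<noteq> c" "z \<noteq> c"
    by (rule nbE2[of v y z]) (use e nb_sym in auto)
  obtain d where d: "nb z = {v, y, d}" "v \<noteq> d" "y \<noteq> d"
    by (rule nbE2[of v z y]) (use e nb_sym in auto)
  have cd: "c \<notin> U" "d \<notin> U"
    using white_deg_eq[OF c(1), of U] white_deg_eq[OF d(1), of U] c d e assms by auto
  have "dec U v = (\<Sum>x\<in>{v, y, z}. wt (white_deg U x)) - (\<Sum>u\<in>{}. inc U {v, y, z} u)"
    by (intro dec_eq[OF UV]) (use v c d e cd in \<open>auto simp: N_def\<close>)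
  then have "dec U v = 21" using e assms by simp
  then show ?thesis using pair_savingI21 assms e by simp
qed

text \<open>Playing the base vertex \<open>y\<close> of white degree 3 removes the triangle, worth 7
  + 6 + 7 = 20, and its only white outer neighbour \<open>c\<close>, which contributes at least 2 by
  \<open>outer_net\<close>.\<close>

lemma ear_32:
  assumes "reach U" "ear U v y z" "white_deg U y = 3" "white_deg U z = 2"
  shows "pair_saving U"
proof -
  have UV: "U \<subseteq> V" using assms(1) by (simp add: reach_def)
  note e = ear_k[OF UV assms(2)]
  have v: "nb v \<inter> U = {y, z}" using assms(2) by (simp add: ear_def)
  obtain c where c: "nb y = {v, z, c}" "v \<noteq> c" "z \<noteq> c"
    by (rule nbE2[of v y z]) (use e nb_sym in auto)
  obtain d where d: "nb z = {v, y, d}" "v \<noteq> d" "y \<noteq> d"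
    by (rule nbE2[of v z y]) (use e nb_sym in auto)
  have cU: "c \<in> U" "d \<notin> U"
    using white_deg_eq[OF c(1), of U] white_deg_eq[OF d(1), of U] c d e assms
      by (auto split: if_splits)
  have yc: "y \<noteq> c" using c nb_irrefl[of y] by auto
  have cv: "c \<notin> nb v" "c \<notin> nb z" using v d cU yc c by auto
  obtain c1 c2 where cc: "nb c = {y, c1, c2}" "y \<noteq> c1" "y \<noteq> c2" "c1 \<noteq> c2" "c1 \<in> nb c2" "c2 \<in> nb c1"
    "c1 \<noteq> c" "c2 \<noteq> c"
    by (rule outer_adj[OF c(1)]) (use cv c nb_iff in auto)
  have ne: "c1 \<noteq> v" "c1 \<noteq> z" "c2 \<noteq> v" "c2 \<noteq> z" using cv cc(1) nb_iff[of c] by auto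
  define A where "A = {v, y, z, c}"
  have h: "nb u \<inter> A = {c}" if "u \<in> {c1, c2}" "u \<in> U" for u
  proof -
    have "u \<notin> nb v" "u \<notin> nb z" "u \<notin> nb y" "u \<in> nb c" using that v d c cc ne cU by auto
    then show ?thesis unfolding A_def by (simp add: nb_Int_insert)
  qed
  have "dec U y = (\<Sum>x\<in>A. wt (white_deg U x)) - (\<Sum>y\<in>{c1, c2}. inc U A y)"
    by (intro dec_eq[OF UV]) (use v c d e cU cc ne in \<open>auto simp: N_def A_def\<close>)
  then have "dec U y = 20 + (wt (white_deg U c) - inc U A c1 - inc U A c2)"
    using e assms c yc cc by (simp add: A_def)
  moreover have "wt (white_deg U c) - inc U A c1 - inc U A c2 \<ge> 2"
    by (rule outer_net(5)[OF UV _ cc(1-5)]) (use h cU e in \<open>auto simp: A_def\<close>)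
  ultimately show ?thesis using pair_savingI21[of U y] assms e by simp
qed

lemma ear_sym: "ear U v y z \<Longrightarrow> ear U v z y"
  unfolding ear_def using nb_sym by blast

lemma ear_nb_outside:
  assumes "ear (U - A) s p q" "nb s \<inter> A = {}"
  shows "ear U s p q"
  using assms unfolding ear_def by blast

text \<open>A base vertex of white degree 2 has no white neighbour outside the triangle, so it can
  serve as the tip.\<close>

lemma ear_rotate:
  assumes "U \<subseteq> V" "ear U s p q" "white_deg U p = 2"
  shows "ear U p s q"
proof -
  note e = ear_k[OF assms(1,2)]
  have sub: "{s, q} \<subseteq> nb p \<inter> U" using e nb_iff by blast
  moreover have "card (nb p \<inter> U) = 2" using assms(3) by (simp add: white_deg_def)
  moreover have "card {s, q} = 2" using e by simp
  ultimately have "{s, q} = nb p \<inter> U" by (intro card_subset_eq) auto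
  then show ?thesis using e nb_sym[of q s] nb_sym[of s q] unfolding ear_def by blast
qed


lemma white_deg_3D:
  assumes "nb x = {p, q, r}" "white_deg U x = 3"
  shows "p \<in> U" "q \<in> U" "r \<in> U"
proof -
  have "card (nb x) \<le> 3" using assms(1) by (simp add: card_insert_if)
  then have "nb x \<inter> U = nb x" using assms(2) unfolding white_deg_def by (intro card_seteq) auto
  then show "p \<in> U" "q \<in> U" "r \<in> U" using assms(1) by auto
qed

text \<open>Playing \<open>y\<close> removes the triangle, worth 7 + 6 + 6 = 19, and
  \<open>c\<close>, while \<open>d\<close> survives and gets heavier. The heavier of the two outer
  neighbours should go and the one with the smaller increase should stay; hence the assumption on
  their white degrees.\<close>

lemma ear_33_apart:
  assumes "reach U" "ear U v y z" "nb y = {v, z, c}" "nb z = {v, y, d}" "v \<noteq> c" "z \<noteq> c" "v \<noteq> d"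
    "y \<noteq> d"
    and "c \<in> U" "d \<in> U" "c \<noteq> d" "d \<notin> nb c" "white_deg U c \<le> white_deg U d"
  shows "pair_saving U"
proof -
  have UV: "U \<subseteq> V" using assms(1) by (simp add: reach_def)
  note e = ear_k[OF UV assms(2)]
  have v: "nb v \<inter> U = {y, z}" using assms(2) by (simp add: ear_def)
  have k3: "white_deg U y = 3" "white_deg U z = 3"
    using white_deg_eq[OF assms(3), of U] white_deg_eq[OF assms(4), of U] assms e by auto
  have yc: "y \<noteq> c" "z \<noteq> d" using assms nb_irrefl[of y] nb_irrefl[of z] by auto
  have cv: "c \<notin> nb v" "c \<notin> nb z" "d \<notin> nb v" "d \<notin> nb y" using v assms yc by auto
  obtain c1 c2 where cc: "nb c = {y, c1, c2}" "y \<noteq> c1" "y \<noteq> c2" "c1 \<noteq> c2" "c1 \<in> nb c2" "c2 \<in> nb c1"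
    "c1 \<noteq> c" "c2 \<noteq> c"
    by (rule outer_adj[OF assms(3)]) (use cv assms nb_iff in auto)
  have ne: "c1 \<noteq> v" "c1 \<noteq> z" "c2 \<noteq> v" "c2 \<noteq> z" using cv cc(1) nb_iff[of c] by auto
  have dc: "d \<noteq> c1" "d \<noteq> c2" using assms cc by auto
  define A where "A = {v, y, z, c}"
  have h: "nb u \<inter> A = {c}" if "u \<in> {c1, c2}" "u \<in> U" for u
  proof -
    have "u \<notin> nb v" "u \<notin> nb z" "u \<notin> nb y" "u \<in> nb c" using that v assms cc ne dc by auto
    then show ?thesis unfolding A_def by (simp add: nb_Int_insert)
  qed
  have AU: "A \<subseteq> U" using e assms A_def by auto
  have hd: "nb d \<inter> A = {z}"
    using cv assms unfolding A_def by (simp add: nb_Int_insert)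
  have "dec U y = (\<Sum>x\<in>A. wt (white_deg U x)) - (\<Sum>u\<in>{c1, c2, d}. inc U A u)"
    by (intro dec_eq[OF UV]) (use v assms e cc ne dc yc in \<open>auto simp: N_def A_def\<close>)
  then have dec: "dec U y = 19 + (wt (white_deg U c) - inc U A c1 - inc U A c2) - inc U A d"
    using e k3 assms yc cc dc by (simp add: A_def)
  define net where "net = wt (white_deg U c) - inc U A c1 - inc U A c2"
  note net = outer_net[OF UV AU cc(1-5) e(5) assms(9) h[of c1] h[of c2] net_def, simplified]
  have id: "inc U A d = 4 - int (white_deg U d)" "white_deg U d \<ge> 1" "white_deg U d \<le> 3"
    using inc_single[OF assms(10) UV hd AU] .
  \<comment> \<open>The totals are at least 19 + 9 - 3, 19 + 4 - 2 and, in the last case, 19 + 3 -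
    1. In the third case 21 can be missed, but then \<open>c1\<close> is the tip of an ear with base
    degrees 3 and 2, which \<open>ear_32\<close> settles.\<close>
  consider "white_deg U c = 1" | "white_deg U c = 2" | "white_deg U c = 3" "white_deg U c1 = 2"
    "white_deg U c2 = 2" | "white_deg U c = 3" "net \<ge> 3"
    using net by linarith
  then show ?thesis
  proof cases
    case 3
    have U: "c1 \<in> U" "c2 \<in> U" using white_deg_3D[OF cc(1) 3(1)] by auto
    have "nb c1 \<inter> U = {c, c2}"
    proof -
      have "{c, c2} \<subseteq> nb c1 \<inter> U" using cc U assms nb_iff by auto
      moreover have "card (nb c1 \<inter> U) = 2" using 3 by (simp add: white_deg_def)
      moreover have "card {c, c2} = 2" using cc by simp
      ultimately show ?thesis by (metis card_subset_eq finite_Int finite_nb)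
    qed
    then have "ear U c1 c c2" using U cc nb_sym[of c2 c] by (auto simp: ear_def nb_iff[of c c2])
    then show ?thesis using ear_32 assms 3 by blast
  qed (use pair_savingI21[OF assms(1) e(5)] dec id net net_def assms(13) in linarith)+
qed

text \<open>The outer neighbours \<open>c\<close>, \<open>d\<close> of the base coincide, are apart,
  or are adjacent. In the last case they form a second triangle with a common neighbour
  \<open>e'\<close>. If \<open>e'\<close> is white of white degree 2, the move \<open>y\<close> is
  worth only 20, and old ears elsewhere could spoil the round; the assumption \<open>no22\<close>
  makes the base degrees of those sum to at least 5.\<close>

lemma ear_33:
  assumes "reach U" "ear U v y z" "white_deg U y = 3" "white_deg U z = 3"
    and no22: "\<And>x p q. ear U x p q \<Longrightarrow> white_deg U p = 2 \<Longrightarrow> white_deg U q = 2 \<Longrightarrow> False"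
  shows "pair_saving U"
proof -
  have UV: "U \<subseteq> V" using assms(1) by (simp add: reach_def)
  note e = ear_k[OF UV assms(2)]
  have v: "nb v \<inter> U = {y, z}" using assms(2) by (simp add: ear_def)
  obtain c where c: "nb y = {v, z, c}" "v \<noteq> c" "z \<noteq> c"
    by (rule nbE2[of v y z]) (use e nb_sym in auto)
  obtain d where d: "nb z = {v, y, d}" "v \<noteq> d" "y \<noteq> d"
    by (rule nbE2[of v z y]) (use e nb_sym in auto)
  have cU: "c \<in> U" "d \<in> U"
    using white_deg_3D[OF c(1) assms(3)] white_deg_3D[OF d(1) assms(4)] by auto
  have yc: "y \<noteq> c" "z \<noteq> d" using c d nb_irrefl[of y] nb_irrefl[of z] by auto
  show ?thesis
  proof (cases "c = d")
    case True
    have "y \<in> nb c" "z \<in> nb c" using c d True nb_iff by auto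
    then obtain c' where c': "nb c = {y, z, c'}" "y \<noteq> c'" "z \<noteq> c'" using e(10) by (rule nbE2)
    have cv: "c \<notin> nb v" using v cU yc True by auto
    then have vc: "v \<noteq> c'" using c' nb_iff[of v c] by auto
    have cc': "c \<noteq> c'" using c' nb_irrefl[of c] by auto
    define A where "A = {v, y, z, c}"
    have "nb c' \<inter> A = {c}" if "c' \<in> U"
    proof -
      have "c' \<notin> nb v" "c' \<notin> nb z" "c' \<notin> nb y" "c' \<in> nb c" using that v c d True c' vc cc' by auto
      then show ?thesis unfolding A_def by (simp add: nb_Int_insert)
    qed
    moreover have "A \<subseteq> U" using cU e by (simp add: A_def)
    ultimately have i: "inc U A c' \<le> 3" by (rule inc_single_le[OF UV])
    have "dec U y = (\<Sum>x\<in>A. wt (white_deg U x)) - (\<Sum>u\<in>{c'}. inc U A u)"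
      by (intro dec_eq[OF UV]) (use v c d e cU c' cc' True vc in \<open>auto simp: N_def A_def\<close>)
    then have "dec U y = 19 + wt (white_deg U c) - inc U A c'"
      using e assms(1-4) c d yc True by (simp add: A_def)
    then have "dec U y \<ge> 21" using i wt_ge_6[of "white_deg U c"] by linarith
    then show ?thesis using pair_savingI21 assms(1-4) e by blast
  next
    case ncd: False
    have cv: "c \<notin> nb v" "c \<notin> nb z" "d \<notin> nb v" "d \<notin> nb y" using v cU ncd c d yc by auto
    show ?thesis
    proof (cases "d \<in> nb c")
      case False
      have "white_deg U c \<le> white_deg U d \<or> white_deg U d \<le> white_deg U c" by linarith
      then show ?thesis
        using ear_33_apart[OF assms(1,2) c(1) d(1)] ear_33_apart[OF assms(1) ear_sym[OF assms(2)]
          d(1) c(1)]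
          c d cU ncd False nb_iff[of d c] by blast
    next
      case True
      have "y \<in> nb c" using c nb_iff by auto
      then obtain e' where e': "nb c = {y, d, e'}" "y \<noteq> e'" "d \<noteq> e'" using True d(3) by (rule nbE2)
      have ce: "c \<noteq> e'" using e' nb_irrefl[of c] by auto
      have ev: "e' \<noteq> v" "e' \<noteq> z" using cv e' nb_iff[of c] by auto
      have "d \<in> nb e'"
      proof -
        have "d \<in> nb e' \<or> d \<in> nb y \<or> e' \<in> nb y" using no_claw[of d c e' y] e' d by auto
        then show ?thesis using cv(4) c ce ev by auto
      qed
      then have "e' \<in> nb d" and "z \<in> nb d" and "c \<in> nb d" using d True nb_iff by auto
      have nd: "nb d = {z, c, e'}"
        by (rule nbE2[OF \<open>z \<in> nb d\<close> \<open>c \<in> nb d\<close> c(3)]) (use \<open>e' \<in> nb d\<close> ce ev in auto)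
      define A where "A = {v, y, z, c}"
      have AU: "A \<subseteq> U" using e cU A_def by auto
      have hd: "nb d \<inter> A = {z, c}" using cv d True unfolding A_def by (simp add: nb_Int_insert)
      have he: "nb e' \<inter> A = {c}" if "e' \<in> U"
      proof -
        have "e' \<notin> nb v" "e' \<notin> nb z" "e' \<notin> nb y" "e' \<in> nb c" using that v c d e' ce ev by auto
        then show ?thesis unfolding A_def by (simp add: nb_Int_insert)
      qed
      have "dec U y = (\<Sum>x\<in>A. wt (white_deg U x)) - (\<Sum>u\<in>{d, e'}. inc U A u)"
        by (intro dec_eq[OF UV]) (use v c d e cU e' ce ev ncd yc nd in \<open>auto simp: N_def A_def\<close>)
      then have dec: "dec U y = 19 + wt (white_deg U c) - inc U A d - inc U A e'"
        using e assms(1-4) c d yc e' by (simp add: A_def)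
      have kc: "white_deg U c = 2 + of_bool (e' \<in> U)" using white_deg_eq[OF e'(1), of U] e' d e cU
        by simp
      have kd: "white_deg U d = 2 + of_bool (e' \<in> U)"
        using white_deg_eq[OF nd, of U] e' c ce ev e cU by simp
      have id: "inc U A d = (if white_deg U d = 2 then 5 else 3)"
        using inc_double(1)[OF cU(2) UV hd c(3) AU] .
      show ?thesis
      proof (cases "e' \<in> U")
        case False
        then show ?thesis using pair_savingI21[OF assms(1) e(5)] dec kc kd id
          by (simp add: inc_outside)
      next
        case eU: True
        have ie: "inc U A e' = 4 - int (white_deg U e')" "white_deg U e' \<le> 3"
          using inc_single[OF eU UV he[OF eU] AU] by auto
        have ke: "white_deg U e' \<ge> 2"
          using white_deg_ge_2[of d e' c U] \<open>d \<in> nb e'\<close> e' nb_iff[of e' c] cU ncd by auto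
        have dec': "dec U y = 18 + int (white_deg U e')"
        proof -
          have "white_deg U c = 3" "white_deg U d = 3" using kc kd eU by simp_all
          then show ?thesis using dec id ie by simp
        qed
        show ?thesis
        proof (cases "white_deg U e' = 3")
          case True
          then show ?thesis using pair_savingI21[OF assms(1) e(5)] dec' by simp
        next
          case False
          have N: "U - N y = U - A" using c by (auto simp: N_def A_def)
          have ke2: "white_deg U e' = 2" using ke ie False by linarith
          have en: "nb e' \<inter> U = {d, c}"
          proof -
            have "{d, c} \<subseteq> nb e' \<inter> U" using \<open>d \<in> nb e'\<close> e' nb_iff[of e' c] cU by auto
            moreover have "card (nb e' \<inter> U) = 2" using ke2 by (simp add: white_deg_def)
            moreover have "card {d, c} = 2" using ncd by simp
            ultimately show ?thesis by (metis card_subset_eq finite_Int finite_nb)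
          qed
          have kd': "white_deg (U - A) d \<le> 1" "white_deg (U - A) e' \<le> 1"
          proof -
            have "nb d \<inter> (U - A) \<subseteq> {e'}" "nb e' \<inter> (U - A) \<subseteq> {d}" using nd en A_def by auto
            then have "white_deg (U - A) d \<le> card {e'}" "white_deg (U - A) e' \<le> card {d}"
              unfolding white_deg_def by (meson card_mono finite.intros)+
            then show "white_deg (U - A) d \<le> 1" "white_deg (U - A) e' \<le> 1" by auto
          qed
          \<comment> \<open>The vertices of an ear keep white degree at least 2, while the only
            survivors touched by the move, \<open>d\<close> and \<open>e'\<close>, drop to at most
            1. So every ear that remains is an untouched old one.\<close>
          have away: "nb u \<inter> A = {}" if "u \<in> U - A" "white_deg (U - A) u \<ge> 2" for u
          proof -
            have "u \<noteq> d" "u \<noteq> e'" using that kd' by auto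
            then have "u \<notin> nb v" "u \<notin> nb y" "u \<notin> nb z" "u \<notin> nb c" using that v c d e' A_def by auto
            then show ?thesis unfolding A_def by (simp add: nb_Int_insert)
          qed
          show ?thesis
          proof (rule pair_savingI[OF assms(1), of y])
            fix x p q assume "ear (U - N y) x p q"
            then have ear': "ear (U - A) x p q" using N by simp
            have UA: "U - A \<subseteq> V" using UV by auto
            note e' = ear_k[OF UA ear']
            have 1: "ear U x p q" using ear_nb_outside[OF ear'] away[of x] e' by auto
            have "white_deg (U - A) u = white_deg U u" if "u \<in> {p, q}" for u
            proof -
              have "nb u \<inter> A = {}" using away[of u] that e' by auto
              then have "nb u \<inter> (U - A) = nb u \<inter> U" by auto
              then show ?thesis by (simp add: white_deg_def)
            qed
            then have "\<not> (white_deg (U - A) p = 2 \<and> white_deg (U - A) q = 2)" using no22[OF 1]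
              by auto
            then show "dec U y + int (white_deg (U - N y) p) + int (white_deg (U - N y) q) \<ge> 25"
              using e'(2,3) dec' ke2 N by auto
          qed (use e UV dec' in \<open>auto simp: N_def\<close>)
        qed
      qed
    qed
  qed
qed

lemma ear_pair_saving:
  assumes "reach U" "ear U v y z"
  shows "pair_saving U"
proof (rule ccontr)
  assume ng: "\<not> pair_saving U"
  have UV: "U \<subseteq> V" using assms(1) by (simp add: reach_def)
  have no22: False if "ear U x p q" "white_deg U p = 2" "white_deg U q = 2" for x p q
    using ear_22[OF assms(1) that] ng by blast
  show False
    using ear_k(2,3)[OF UV assms(2)] no22[OF assms(2)] ear_32[OF assms] ear_33[OF assms _ _ no22]
      ear_32[OF assms(1) ear_sym[OF assms(2)]] ng by auto
qed

section \<open>White vertices of white degree three\<close>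

lemma ear_hit:
  assumes "\<And>x y z. \<not> ear U x y z" "ear (U - A) s p q"
  shows "s \<in> U - A" "\<exists>a \<in> A. s \<in> nb a"
proof -
  show "s \<in> U - A" using assms(2) by (simp add: ear_def)
  have "nb s \<inter> A \<noteq> {}" using assms ear_nb_outside by blast
  then show "\<exists>a \<in> A. s \<in> nb a" using nb_sym by blast
qed

text \<open>By \<open>ear_rotate\<close> a base vertex of white degree 2 is a tip as well and hence
  one of \<open>h\<close>, \<open>h'\<close>. Three tips in one triangle are impossible, so at most
  one base vertex has white degree 2, and then both \<open>h\<close> and \<open>h'\<close> are
  tips.\<close>

lemma ear_sum:
  assumes UV: "U \<subseteq> V" and e: "ear (U - A) s x y"
    and H: "\<And>s x y. ear (U - A) s x y \<Longrightarrow> s \<in> {h, h'}"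
  shows "white_deg (U - A) x + white_deg (U - A) y = 6
    \<or> white_deg (U - A) x + white_deg (U - A) y = 5 \<and> (\<exists>x y. ear (U - A) h x y) \<and> (\<exists>x y. ear (U - A)
      h' x y)"
proof -
  have UA: "U - A \<subseteq> V" using UV by auto
  note ek = ear_k[OF UA e]
  have s: "s \<in> {h, h'}" using H[OF e] .
  have x: "x \<in> {h, h'} \<and> ear (U - A) x s y" if "white_deg (U - A) x = 2"
    using H[OF ear_rotate[OF UA e that]] ear_rotate[OF UA e that] by blast
  have y: "y \<in> {h, h'} \<and> ear (U - A) y s x" if "white_deg (U - A) y = 2"
    using H[OF ear_rotate[OF UA ear_sym[OF e] that]] ear_rotate[OF UA ear_sym[OF e] that] by blast
  consider "white_deg (U - A) x = 3" "white_deg (U - A) y = 3" | "white_deg (U - A) x = 2"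
    "white_deg (U - A) y = 3"
    | "white_deg (U - A) x = 3" "white_deg (U - A) y = 2" | "white_deg (U - A) x = 2"
      "white_deg (U - A) y = 2"
    using ek by auto
  then show ?thesis
  proof cases
    case 2
    then have "{s, x} = {h, h'}" using s x ek by auto
    then show ?thesis using 2 x e by (auto simp: doubleton_eq_iff)
  next
    case 3
    then have "{s, y} = {h, h'}" using s y ek by auto
    then show ?thesis using 3 y e by (auto simp: doubleton_eq_iff)
  next
    case 4
    then show ?thesis using s x y ek by auto
  qed simp
qed

text \<open>A complete graph on the four vertices is a component worth 24. Otherwise the absence of
  ears makes both outer neighbours \<open>z'\<close>, \<open>w'\<close> white. If neither has white
  degree 1, the move \<open>x\<close> is worth at least 24 - 2 - 2 = 20, and only \<open>z'\<close>
  and \<open>w'\<close> can become tips, so \<open>ear_sum\<close> supplies the missing 5.\<close>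

lemma diamond_pair_saving:
  assumes r: "reach U" and no: "\<And>x y z. \<not> ear U x y z"
    and "x \<in> U" "y \<in> U" "z \<in> U" "w \<in> U" and nx: "nb x = {y, z, w}" and ny: "nb y = {x, z, w}"
    and ne: "x \<noteq> y" "x \<noteq> z" "x \<noteq> w" "y \<noteq> z" "y \<noteq> w" "z \<noteq> w"
  shows "pair_saving U"
proof -
  have UV: "U \<subseteq> V" using r by (simp add: reach_def)
  have kxy: "white_deg U x = 3" "white_deg U y = 3"
    using white_deg_eq[OF nx, of U] white_deg_eq[OF ny, of U] assms(3-6) ne by simp_all
  have xy: "x \<in> nb z" "y \<in> nb z" "x \<in> nb w" "y \<in> nb w" "x \<in> nb y" using nx ny nb_iff by auto
  obtain z' where z': "nb z = {x, y, z'}" "x \<noteq> z'" "y \<noteq> z'" by (rule nbE2[OF xy(1,2) ne(1)])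
  obtain w' where w': "nb w = {x, y, w'}" "x \<noteq> w'" "y \<noteq> w'" by (rule nbE2[OF xy(3,4) ne(1)])
  have U: "z' \<in> U" "w' \<in> U"
  proof -
    have "nb z \<inter> U \<noteq> {x, y}" "nb w \<inter> U \<noteq> {x, y}"
      using no[of z x y] no[of w x y] assms(3-6) ne xy(5) unfolding ear_def by blast+
    then show "z' \<in> U" "w' \<in> U" using z'(1) w'(1) assms(3-6) by auto
  qed
  have kzw: "white_deg U z = 3" "white_deg U w = 3"
    using white_deg_eq[OF z'(1), of U] white_deg_eq[OF w'(1), of U] z' w' U assms(3-6) ne
      by simp_all
  have zz: "z \<noteq> z'" "w \<noteq> w'" using z' w' nb_irrefl by auto
  have zz': "z \<in> nb z'" "w \<in> nb w'" using z' w' nb_iff by auto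
  show ?thesis
  proof (cases "z' = w")
    case True
    then have "z \<in> {x, y, w'}" using zz'(1) w'(1) by simp
    then have "w' = z" using ne by simp
    have "dec U x = (\<Sum>u\<in>{x, y, z, w}. wt (white_deg U u)) - (\<Sum>u\<in>{}. inc U {x, y, z, w} u)"
      by (intro dec_eq[OF UV]) (use assms(3-6) nx ny z' w' True \<open>w' = z\<close> in \<open>auto simp: N_def\<close>)
    then have "dec U x = 24" using ne kxy kzw by simp
    then show ?thesis using pair_savingI21[OF r assms(3)] by simp
  next
    case False
    have "w' \<noteq> z"
    proof
      assume "w' = z"
      then have "w \<in> {x, y, z'}" using zz'(2) z'(1) by simp
      then show False using ne False by simp
    qed
    have nzw: "w \<notin> nb z" "z \<notin> nb w" using z' w' False \<open>w' \<noteq> z\<close> ne by auto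
    \<comment> \<open>If \<open>z\<close> and \<open>w\<close> shared the outer neighbour
      \<open>z'\<close>, claw-freeness there would make its third neighbour \<open>t\<close>
      adjacent to \<open>z\<close> or \<open>w\<close>; then \<open>t\<close> is \<open>x\<close> or
      \<open>y\<close>, whose neighbours do not include \<open>z'\<close>.\<close>
    have zw': "z' \<noteq> w'"
    proof
      assume eq: "z' = w'"
      obtain t where t: "nb z' = {z, w, t}" "z \<noteq> t" "w \<noteq> t"
        by (rule nbE2[of z z' w]) (use zz' eq ne in auto)
      have tz: "t \<noteq> z'" using t nb_irrefl[of z'] by auto
      have "z \<in> nb w \<or> z \<in> nb t \<or> w \<in> nb t" using no_claw[of z z' w t] t ne by auto
      then have "t \<in> {x, y}" using nzw nb_iff[of z t] nb_iff[of w t] z' w' eq tz by auto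
      then have "z' \<in> {y, z, w, x}" using t nx ny nb_iff[of t z'] by auto
      then show False using z' zz False by auto
    qed
    have out: "z' \<notin> nb x" "z' \<notin> nb y" "w' \<notin> nb x" "w' \<notin> nb y" "z' \<notin> nb w" "w' \<notin> nb z"
      using nx ny z' w' zz False \<open>w' \<noteq> z\<close> zw' by auto
    \<comment> \<open>Used for both ends of the diamond. Playing the corner \<open>c\<close> takes
      along the pendant \<open>c'\<close>, and the opposite corner \<open>d\<close> drops from white
      degree 3 to 1: the move is worth 3 * 6 + 9 - 3 = 24.\<close>
    have end_pair_saving: "pair_saving U"
      if hy: "nb c = {x, y, c'}" "c' \<in> U" "white_deg U c' = 1" "{c, d} = {z, w}" "c' \<notin> nb x"
        "c' \<notin> nb y" "c' \<notin> nb d" "c' \<noteq> d"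
        "c' \<noteq> x" "c' \<noteq> y"
      for c c' d
    proof -
      have cd: "c \<in> U" "d \<in> U" "c \<noteq> d" "d \<notin> nb c" "white_deg U c = 3" "white_deg U d = 3" "x \<noteq> c"
        "y \<noteq> c" "x \<noteq> d" "y \<noteq> d"
        "d \<in> nb x" "d \<in> nb y" "nb x = {y, c, d}" "nb y = {x, c, d}"
        using hy(4) assms(3-6) ne nzw kzw nx ny by (auto simp: doubleton_eq_iff insert_commute)
      have cc: "c' \<noteq> c" using hy(1) nb_irrefl[of c] by auto
      define A where "A = {c, x, y, c'}"
      have "c \<in> nb c'" using hy(1) nb_iff[of c c'] by simp
      moreover obtain u where "nb c' \<inter> U = {u}" using hy(3) by (rule white_deg_1E)
      ultimately have nc': "nb c' \<inter> U = {c}" using cd by auto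
      have AU: "A \<subseteq> U" using cd assms(3-6) hy A_def by auto
      have "d \<notin> nb c'" using hy(7) nb_iff by blast
      then have "nb d \<inter> A = {x, y}" using cd unfolding A_def by (simp add: nb_Int_insert)
      then have i: "inc U A d = 3" using inc_double(1)[OF cd(2) UV _ ne(1) AU] cd by simp
      have "dec U c = (\<Sum>u\<in>A. wt (white_deg U u)) - (\<Sum>u\<in>{d}. inc U A u)"
        by (intro dec_eq[OF UV]) (use assms(3-6) nc' cd hy cc in \<open>auto simp: N_def A_def\<close>)
      then have "dec U c = 24" using i ne cd hy kxy cc by (simp add: A_def)
      then show ?thesis using pair_savingI21[OF r cd(1)] by simp
    qed
    define A where "A = {x, y, z, w}"
    have AU: "A \<subseteq> U" using assms(3-6) A_def by auto
    have hz: "nb z' \<inter> A = {z}" "nb w' \<inter> A = {w}"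
      using out z' w' unfolding A_def by (auto simp: nb_Int_insert)
    note iz = inc_single[OF U(1) UV hz(1) AU] and iw = inc_single[OF U(2) UV hz(2) AU]
    show ?thesis
    proof (cases "white_deg U z' = 1 \<or> white_deg U w' = 1")
      case True
      then show ?thesis
        using end_pair_saving[OF z'(1) U(1), of w] end_pair_saving[OF w'(1) U(2), of z] out z' w'
          False \<open>w' \<noteq> z\<close> by auto
    next
      case k1: False
      have "dec U x = (\<Sum>u\<in>A. wt (white_deg U u)) - (\<Sum>u\<in>{z', w'}. inc U A u)"
        by (intro dec_eq[OF UV]) (use assms(3-6) nx ny z' w' zz False \<open>w' \<noteq> z\<close> in \<open>auto simp: N_def
          A_def\<close>)
      then have "dec U x = 24 - inc U A z' - inc U A w'" using ne kxy kzw zw' by (simp add: A_def)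
      then have dec: "dec U x \<ge> 20" using iz iw k1 by auto
      have N: "U - N x = U - A" using nx by (auto simp: N_def A_def)
      have H: "s \<in> {z', w'}" if "ear (U - A) s p q" for s p q
      proof -
        have "s \<notin> A" "\<exists>a \<in> A. s \<in> nb a" using ear_hit[OF no that] by auto
        then show ?thesis using nx ny z' w' unfolding A_def by auto
      qed
      show ?thesis
      proof (rule pair_savingI[OF r, of x])
        fix s p q assume "ear (U - N x) s p q"
        then have "ear (U - A) s p q" using N by simp
        then have "white_deg (U - A) p + white_deg (U - A) q \<ge> 5" using ear_sum[OF UV _ H]
          by fastforce
        then show "dec U x + int (white_deg (U - N x) p) + int (white_deg (U - N x) q) \<ge> 25"
          using dec N by simp
      qed (use assms(3) UV dec in \<open>auto simp: N_def\<close>)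
    qed
  qed
qed

section \<open>White triangles with three different white outer neighbours\<close>

definition spread :: "'a set \<Rightarrow> 'a \<Rightarrow> 'a \<Rightarrow> 'a \<Rightarrow> 'a \<Rightarrow> 'a \<Rightarrow> 'a \<Rightarrow> bool" where
  "spread U v a b p q r \<longleftrightarrow> {v, a, b, p, q, r} \<subseteq> U \<and> distinct [v, a, b, p, q, r]
    \<and> nb v = {a, b, p} \<and> nb a = {v, b, q} \<and> nb b = {v, a, r}"

lemma spread_swap:
  assumes "spread U v a b p q r"
  shows "spread U a v b q p r" "spread U v b a p r q"
  using assms unfolding spread_def by (auto simp: insert_commute)

text \<open>Claw-freeness at \<open>v\<close> yields the triangle. A dominated outer neighbour of
  \<open>a\<close> or \<open>b\<close> would make that vertex the tip of an ear, and an outer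
  neighbour shared by two triangle vertices would complete a diamond.\<close>

lemma spread_exists:
  assumes r: "reach U" and ng: "\<not> pair_saving U" and v: "v \<in> U" "white_deg U v = 3"
  obtains a b p q r where "spread U v a b p q r"
proof -
  have UV: "U \<subseteq> V" using r by (simp add: reach_def)
  have no: "\<not> ear U x y z" for x y z using ear_pair_saving[OF r] ng by blast
  have "card (nb v) = 3" using v UV card_nb by blast
  then obtain a0 where "a0 \<in> nb v" by (metis card.empty ex_in_conv zero_neq_numeral)
  then obtain b0 c0 where n0: "nb v = {a0, b0, c0}" "a0 \<noteq> b0" "a0 \<noteq> c0" "b0 \<noteq> c0" by (rule nbE1)
  have "a0 \<in> nb b0 \<or> a0 \<in> nb c0 \<or> b0 \<in> nb c0" using no_claw[of a0 v b0 c0] n0 by auto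
  then have "\<exists>a b c. nb v = {a, b, c} \<and> a \<noteq> b \<and> a \<noteq> c \<and> b \<noteq> c \<and> a \<in> nb b"
  proof (elim disjE)
    assume "a0 \<in> nb b0"
    then show ?thesis using n0 by blast
  next
    assume "a0 \<in> nb c0"
    moreover have "nb v = {a0, c0, b0}" using n0(1) by blast
    ultimately show ?thesis using n0(2-4) by metis
  next
    assume "b0 \<in> nb c0"
    moreover have "nb v = {b0, c0, a0}" using n0(1) by blast
    ultimately show ?thesis using n0(2-4) by metis
  qed
  then obtain a b c where n: "nb v = {a, b, c}" "a \<noteq> b" "a \<noteq> c" "b \<noteq> c" and ab: "a \<in> nb b"
    by blast
  have ba: "b \<in> nb a" using ab by (rule nb_sym)
  have U: "a \<in> U" "b \<in> U" "c \<in> U" using white_deg_3D[OF n(1) v(2)] by auto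
  have ne: "v \<noteq> a" "v \<noteq> b" "v \<noteq> c" using n nb_irrefl[of v] by auto
  have va: "v \<in> nb a" "v \<in> nb b" using n nb_iff[of v a] nb_iff[of v b] by auto
  obtain q where q: "nb a = {v, b, q}" "v \<noteq> q" "b \<noteq> q" using va(1) ba ne(2) by (rule nbE2)
  obtain r where r': "nb b = {v, a, r}" "v \<noteq> r" "a \<noteq> r" using va(2) ab ne(1) by (rule nbE2)
  have aq: "a \<noteq> q" "b \<noteq> r" using q r' nb_irrefl[of a] nb_irrefl[of b] by auto
  have qU: "q \<in> U"
  proof (rule ccontr)
    assume "q \<notin> U"
    then have "ear U a v b" using q U v ne n va by (auto simp: ear_def)
    then show False using no by blast
  qed
  have rU: "r \<in> U"
  proof (rule ccontr)
    assume "r \<notin> U"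
    then have "ear U b v a" using r' U v ne n va by (auto simp: ear_def)
    then show False using no by blast
  qed
  have "q \<noteq> c"
    using diamond_pair_saving[OF r no v(1) U n(1), of] q ne n ng by blast
  moreover have "r \<noteq> c"
    using diamond_pair_saving[OF r no v(1) U(2) U(1) U(3), of] r' n ne ng ab
      by (auto simp: insert_commute)
  moreover have "q \<noteq> r"
    using diamond_pair_saving[OF r no U(1) U(2) v(1) qU] q r' n ne ng aq
      by (auto simp: insert_commute)
  ultimately have "spread U v a b c q r"
    using n q r' ne aq U v qU rU unfolding spread_def by auto
  then show ?thesis using that by blast
qed

text \<open>Playing \<open>v\<close> removes the triangle and the pendant \<open>p\<close>; the
  survivors \<open>q\<close> and \<open>r\<close> get heavier by at most 3 each: 18 + 9 - 3 - 3 =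
  21.\<close>

lemma spread_1:
  assumes r: "reach U" and s: "spread U v a b p q r" and k1: "white_deg U p = 1"
  shows "pair_saving U"
proof -
  have UV: "U \<subseteq> V" using r by (simp add: reach_def)
  have U: "v \<in> U" "a \<in> U" "b \<in> U" "p \<in> U" "q \<in> U" "r \<in> U"
    and d: "distinct [v, a, b, p, q, r]"
    and nv: "nb v = {a, b, p}" and na: "nb a = {v, b, q}" and nb': "nb b = {v, a, r}"
    using s by (auto simp: spread_def)
  have k3: "white_deg U v = 3" "white_deg U a = 3" "white_deg U b = 3"
    using white_deg_eq[OF nv, of U] white_deg_eq[OF na, of U] white_deg_eq[OF nb', of U] U d by auto
  define A where "A = {v, a, b, p}"
  have AU: "A \<subseteq> U" using U A_def by auto
  obtain u where "nb p \<inter> U = {u}" using k1 by (rule white_deg_1E)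
  moreover have "v \<in> nb p" using nv nb_iff[of v p] by simp
  ultimately have np: "nb p \<inter> U = {v}" using U by auto
  then have "q \<notin> nb p" "r \<notin> nb p" using U d by auto
  then have h: "nb q \<inter> A = {a}" "nb r \<inter> A = {b}"
    using nv na nb' d unfolding A_def by (auto simp: nb_Int_insert)
  have "dec U v = (\<Sum>u\<in>A. wt (white_deg U u)) - (\<Sum>u\<in>{q, r}. inc U A u)"
    by (intro dec_eq[OF UV]) (use U nv na nb' np d in \<open>auto simp: N_def A_def\<close>)
  then have "dec U v = 27 - inc U A q - inc U A r" using k3 k1 d by (simp add: A_def)
  moreover have "inc U A q \<le> 3" "inc U A r \<le> 3" using inc_single_le[OF UV] h AU by blast+
  ultimately show ?thesis using pair_savingI21[OF r U(1)] by linarith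
qed

lemma white_deg_diff_le:
  assumes "x \<in> nb u" "x \<in> A" "A \<subseteq> U" "white_deg U u \<le> 2"
  shows "white_deg (U - A) u \<le> 1"
  using card_outside[OF assms(1-3)] assms(4) by (simp add: white_deg_def)

text \<open>Playing \<open>v\<close> yields 18 + 7 = 25 minus what the survivors gain: 2 + 2 + 3 for
  \<open>q\<close>, \<open>r\<close> and the other white neighbour \<open>t\<close> of
  \<open>p\<close>, or 5 + 2 if \<open>t = q\<close>. The threshold 18 is barely met, so no ear may
  arise. None does: the possible tips \<open>t\<close>, \<open>q\<close>, \<open>r\<close> have
  white degree at most 2 and each loses a neighbour.\<close>

lemma spread_2_aux:
  assumes r: "reach U" and ng: "\<not> pair_saving U" and s: "spread U v a b p q r"
    and k2: "white_deg U p = 2" "white_deg U q = 2" "white_deg U r = 2" and rp: "r \<notin> nb p"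
  shows False
proof -
  have UV: "U \<subseteq> V" using r by (simp add: reach_def)
  have no: "\<not> ear U x y z" for x y z using ear_pair_saving[OF r] ng by blast
  have U: "v \<in> U" "a \<in> U" "b \<in> U" "p \<in> U" "q \<in> U" "r \<in> U"
    and d: "distinct [v, a, b, p, q, r]"
    and nv: "nb v = {a, b, p}" and na: "nb a = {v, b, q}" and nb': "nb b = {v, a, r}"
    using s by (auto simp: spread_def)
  have k3: "white_deg U v = 3" "white_deg U a = 3" "white_deg U b = 3"
    using white_deg_eq[OF nv, of U] white_deg_eq[OF na, of U] white_deg_eq[OF nb', of U] U d by auto
  have pab: "a \<notin> nb p" "b \<notin> nb p" using na nb' d nb_iff[of a p] nb_iff[of b p] by auto
  obtain p1 p2 where pp: "nb p = {v, p1, p2}" "v \<noteq> p1" "v \<noteq> p2" "p1 \<noteq> p2" "p1 \<in> nb p2" "p2 \<in> nb p1"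
    "p1 \<noteq> p" "p2 \<noteq> p"
    by (rule outer_adj[OF nv pab]) (use d in auto)
  have "white_deg U p = 1 + of_bool (p1 \<in> U) + of_bool (p2 \<in> U)"
    using white_deg_eq[OF pp(1-4), of U] U by simp
  then have "p1 \<in> U \<and> p2 \<notin> U \<or> p1 \<notin> U \<and> p2 \<in> U" using k2(1)
    by (auto simp: of_bool_def split: if_splits)
  then obtain t t' where t: "nb p \<inter> U = {v, t}" "t \<in> U" "t \<in> nb p" "t \<noteq> v" "t \<noteq> p" "t' \<in> nb t"
    "t' \<notin> U"
    using pp U by (elim disjE) auto
  have tab: "t \<noteq> a" "t \<noteq> b" "t \<noteq> r" using t(3) pab rp by auto
  define A where "A = {v, a, b, p}"
  have AU: "A \<subseteq> U" using U A_def by auto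
  \<comment> \<open>By \<open>outer_adj\<close> the vertex \<open>t\<close> is adjacent to the
    remaining neighbour \<open>t'\<close> of \<open>p\<close>, which is dominated.\<close>
  have kt: "white_deg U t \<le> 2" using white_deg_le_2[of t t' U] t UV by blast
  have k1: "white_deg (U - A) u \<le> 1" if u: "u \<in> {t, q, r}" for u
  proof -
    have "p \<in> nb t" "a \<in> nb q" "b \<in> nb r"
      using t(3) na nb' nb_iff[of t p] nb_iff[of q a] nb_iff[of r b] by auto
    then obtain x where "x \<in> nb u" "x \<in> A" using u unfolding A_def by auto
    moreover have "white_deg U u \<le> 2" using u kt k2 by auto
    ultimately show ?thesis by (rule white_deg_diff_le[OF _ _ AU])
  qed
  have tn: "t \<notin> nb v" "t \<notin> nb b" using nv nb' t tab d by auto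
  have rn: "nb r \<inter> A = {b}" using nv na nb' rp d unfolding A_def by (auto simp: nb_Int_insert)
  have ir: "inc U A r = 2" using inc_single(1)[OF U(6) UV rn AU] k2 by simp
  have N: "U - N v = U - A" using nv by (auto simp: N_def A_def)
  have dec: "dec U v \<ge> 18"
  proof (cases "t = q")
    case True
    have "nb q \<inter> A = {a, p}" using tn t na True d unfolding A_def by (simp add: nb_Int_insert)
    then have iq: "inc U A q = 5" using inc_double(1)[OF U(5) UV _ _ AU] k2 d by simp
    have "dec U v = (\<Sum>u\<in>A. wt (white_deg U u)) - (\<Sum>u\<in>{q, r}. inc U A u)"
      by (intro dec_eq[OF UV]) (use U nv na nb' t d True in \<open>auto simp: N_def A_def\<close>)
    then show ?thesis using k3 k2 d iq ir by (simp add: A_def)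
  next
    case False
    have "q \<notin> nb p" using t(1) U False d by auto
    then have "nb q \<inter> A = {a}" using nv na nb' d unfolding A_def by (auto simp: nb_Int_insert)
    then have iq: "inc U A q = 2" using inc_single(1)[OF U(5) UV _ AU] k2 by simp
    have "t \<notin> nb a" using na t tab False by auto
    then have "nb t \<inter> A = {p}" using tn t(3) unfolding A_def by (simp add: nb_Int_insert)
    then have it: "inc U A t \<le> 3" using inc_single_le[OF UV _ AU] by blast
    have "dec U v = (\<Sum>u\<in>A. wt (white_deg U u)) - (\<Sum>u\<in>{t, q, r}. inc U A u)"
      by (intro dec_eq[OF UV]) (use U nv na nb' t d tab in \<open>auto simp: N_def A_def\<close>)
    then show ?thesis using k3 k2 d iq ir it False tab by (simp add: A_def)
  qed
  have "pair_saving U"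
  proof (rule pair_savingI[OF r, of v])
    fix s x y assume "ear (U - N v) s x y"
    then have e: "ear (U - A) s x y" using N by simp
    have "s \<in> U - A" "\<exists>a \<in> A. s \<in> nb a" using ear_hit[OF no e] by auto
    then have "s \<in> {t, q, r}" using nv na nb' t(1) unfolding A_def by auto
    then have False using k1[of s] ear_k(1)[OF _ e] UV by auto
    then show "dec U v + int (white_deg (U - N v) x) + int (white_deg (U - N v) y) \<ge> 25" ..
  qed (use U UV dec in \<open>auto simp: N_def\<close>)
  then show False using ng by blast
qed

text \<open>Besides \<open>v\<close> the vertex \<open>p\<close> has only one white neighbour, so it
  is not adjacent to both \<open>q\<close> and \<open>r\<close>; exchanging \<open>a\<close> and
  \<open>b\<close> covers the other case.\<close>

lemma spread_2:
  assumes r: "reach U" and ng: "\<not> pair_saving U" and s: "spread U v a b p q r"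
    and k2: "white_deg U p = 2" "white_deg U q = 2" "white_deg U r = 2"
  shows False
proof (cases "r \<in> nb p")
  case True
  have U: "v \<in> U" "q \<in> U" "r \<in> U" and d: "v \<noteq> q" "v \<noteq> r" "q \<noteq> r" and vp: "v \<in> nb p"
    using s nb_iff[of v p] by (auto simp: spread_def)
  have "q \<notin> nb p"
  proof
    assume "q \<in> nb p"
    then have "{v, q, r} \<subseteq> nb p \<inter> U" using U vp True by auto
    then have "card {v, q, r} \<le> white_deg U p" unfolding white_deg_def by (intro card_mono) auto
    then show False using k2 d by simp
  qed
  then show False using spread_2_aux[OF r ng spread_swap(2)[OF s] k2(1,3,2)] by blast
qed (use spread_2_aux[OF r ng s k2] in blast)

text \<open>The tip has white degree 2 after the move and lost a neighbour to it, since otherwise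
  the ear would have existed before.\<close>

lemma ear_hit_k:
  assumes "U \<subseteq> V" and no: "\<And>x y z. \<not> ear U x y z" and e: "ear (U - A) s x y" and "A \<subseteq> U"
  shows "white_deg U s = 3"
proof -
  have "s \<in> U - A" "\<exists>a \<in> A. s \<in> nb a" using ear_hit[OF no e] by auto
  then obtain a where a: "a \<in> nb s" "a \<in> A" using nb_sym by blast
  have "white_deg (U - A) s = 2" using ear_k(1)[OF _ e] assms(1) by auto
  then have "3 \<le> white_deg U s" using card_outside[OF a assms(4)] by (simp add: white_deg_def)
  then show ?thesis using white_deg_le_3[of s U] \<open>s \<in> U - A\<close> assms(1) by fastforce
qed

text \<open>If \<open>p1\<close> became a tip, its neighbours other than \<open>p\<close> would be
  \<open>p2\<close> and some \<open>t\<close> adjacent to \<open>p2\<close>; then \<open>p1\<close>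
  and \<open>p2\<close> are the centres of a diamond with corners \<open>p\<close> and
  \<open>t\<close>.\<close>

lemma centre_not_ear:
  assumes r: "reach U" and ng: "\<not> pair_saving U" and p: "nb p = {v, p1, p2}" "p1 \<noteq> p2" "p1 \<in> nb p2"
    "v \<noteq> p1" "v \<noteq> p2"
    and U: "p \<in> U" "p1 \<in> U" "p2 \<in> U" and A: "p \<in> A" and e: "ear (U - A) p1 x y"
  shows False
proof -
  have UV: "U \<subseteq> V" using r by (simp add: reach_def)
  have no: "\<not> ear U x y z" for x y z using ear_pair_saving[OF r] ng by blast
  have pp: "p \<noteq> p1" "p \<noteq> p2" using p nb_irrefl[of p] by auto
  have n: "p \<in> nb p1" "p \<in> nb p2" "p2 \<in> nb p1" using p nb_iff[of p] nb_iff[of p1 p2] by auto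
  obtain t where t: "nb p1 = {p2, p, t}" "p2 \<noteq> t" "p \<noteq> t" by (rule nbE2[OF n(3,1)]) (use pp in auto)
  have e': "nb p1 \<inter> (U - A) = {x, y}" "x \<noteq> y" "x \<in> nb y" using e by (auto simp: ear_def)
  have sub: "nb p1 \<inter> (U - A) \<subseteq> {p2, t}" using t(1) A by auto
  have xy: "{x, y} = {p2, t}"
  proof (rule card_subset_eq)
    show "{x, y} \<subseteq> {p2, t}" using sub e'(1) by simp
  qed (use e'(2) t(2) in auto)
  have tU: "t \<in> U" using e'(1) xy by blast
  have tp: "t \<in> nb p2" using xy e'(3) nb_sym[of x y] by (auto simp: doubleton_eq_iff)
  have pt: "p1 \<noteq> t" using t(1) nb_irrefl[of p1] by auto
  obtain t' where t': "nb p2 = {p1, p, t'}" "p1 \<noteq> t'" "p \<noteq> t'"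
    by (rule nbE2[OF p(3) n(2)]) (use pp in auto)
  have "t' = t" using tp t' t pt by auto
  then have "nb p2 = {p1, p, t}" using t' by simp
  then have "pair_saving U"
    using diamond_pair_saving[OF r no U(2,3,1) tU t(1)] p pp t pt by auto
  then show False using ng by blast
qed

text \<open>Playing \<open>v\<close> yields 24 minus the gains of the survivors \<open>q\<close>,
  \<open>p1\<close> on one side and \<open>r\<close>, \<open>p2\<close> on the other;
  \<open>qr\<close> excludes coincidences across the sides. Each side gains at most 3, and at most 2
  if \<open>q\<close> or \<open>r\<close>, respectively, becomes a tip, because that needs white
  degree 3 beforehand. So the move is worth at least 18 plus the number of tips, which just suffices
  with \<open>ear_sum\<close>: 18 + 1 + 6 or 18 + 2 + 5.\<close>

lemma spread_3_aux:
  assumes r: "reach U" and ng: "\<not> pair_saving U" and s: "spread U v a b p q r"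
    and k: "white_deg U p = 3" "white_deg U q \<ge> 2" "white_deg U r \<ge> 2"
    and pp: "nb p = {v, p1, p2}" "v \<noteq> p1" "v \<noteq> p2" "p1 \<noteq> p2" "p1 \<in> nb p2"
    and qr: "q \<noteq> p2" "r \<noteq> p1"
  shows False
proof -
  have UV: "U \<subseteq> V" using r by (simp add: reach_def)
  have no: "\<not> ear U x y z" for x y z using ear_pair_saving[OF r] ng by blast
  have U: "v \<in> U" "a \<in> U" "b \<in> U" "p \<in> U" "q \<in> U" "r \<in> U"
    and d: "distinct [v, a, b, p, q, r]"
    and nv: "nb v = {a, b, p}" and na: "nb a = {v, b, q}" and nb': "nb b = {v, a, r}"
    using s by (auto simp: spread_def)
  have k3: "white_deg U v = 3" "white_deg U a = 3" "white_deg U b = 3"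
    using white_deg_eq[OF nv, of U] white_deg_eq[OF na, of U] white_deg_eq[OF nb', of U] U d by auto
  have pab: "a \<notin> nb p" "b \<notin> nb p" using na nb' d nb_iff[of a p] nb_iff[of b p] by auto
  have pU: "p1 \<in> U" "p2 \<in> U" using white_deg_3D[OF pp(1) k(1)] by auto
  have ne: "p1 \<noteq> p" "p2 \<noteq> p" "p1 \<noteq> a" "p1 \<noteq> b" "p2 \<noteq> a" "p2 \<noteq> b"
    using pp(1) pab nb_irrefl[of p] by auto
  have pn: "p \<in> nb p1" "p \<in> nb p2" "p2 \<in> nb p1" using pp nb_iff[of p] nb_iff[of p1 p2] by auto
  define A where "A = {v, a, b, p}"
  have AU: "A \<subseteq> U" using U A_def by auto
  have N: "U - N v = U - A" using nv by (auto simp: N_def A_def)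
  \<comment> \<open>Were the third neighbour of \<open>c\<close> dominated, \<open>c\<close> would
    be the tip of an ear with base \<open>p\<close>, \<open>c'\<close>.\<close>
  have kp: "white_deg U c = 3" if "nb p = {v, c, c'}" "c \<in> U" "c' \<in> U" "c \<in> nb c'" "c \<noteq> c'"
    "c' \<noteq> p" for c c'
  proof -
    have n: "p \<in> nb c" "c' \<in> nb c" "c' \<in> nb p" using that nb_sym[of c p] nb_sym[of c c'] by auto
    have "white_deg U c \<noteq> 2"
    proof
      assume k2: "white_deg U c = 2"
      have "{p, c'} = nb c \<inter> U"
        by (rule card_subset_eq) (use n that U k2 in \<open>auto simp: white_deg_def\<close>)
      then show False using no[of c p c'] that n nb_sym[OF n(3)] unfolding ear_def by auto
    qed
    moreover have "white_deg U c \<ge> 2" using white_deg_ge_2[OF n(1,2)] that U by auto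
    moreover have "white_deg U c \<le> 3" using white_deg_le_3 that UV by blast
    ultimately show ?thesis by linarith
  qed
  have kp1: "white_deg U p1 = 3" using kp[OF pp(1) pU pp(5,4) ne(2)] .
  have kp2: "white_deg U p2 = 3" using kp[of p2 p1] pp pU pn ne by (simp add: insert_commute)
  have ql: "white_deg U q \<le> 3" "white_deg U r \<le> 3" using white_deg_le_3 U UV by blast+
  define E where "E u \<longleftrightarrow> (\<exists>x y. ear (U - A) u x y)" for u
  have E3: "white_deg U u = 3" if "E u" for u using that ear_hit_k[OF UV no _ AU] unfolding E_def
    by blast
  have Ep: "\<not> E p1" "\<not> E p2"
    using centre_not_ear[OF r ng pp(1) pp(4) pp(5) pp(2,3) U(4) pU, of A]
      centre_not_ear[OF r ng, of p v p2 p1 A] pp pU U pn A_def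
    unfolding E_def by (auto simp: insert_commute)
  have H: "u \<in> {q, r}" if "ear (U - A) u x y" for u x y
  proof -
    have "u \<in> U - A" "\<exists>a \<in> A. u \<in> nb a" using ear_hit[OF no that] by auto
    moreover have "u \<noteq> p1" "u \<noteq> p2" using that Ep unfolding E_def by blast+
    ultimately show ?thesis using nv na nb' pp(1) unfolding A_def by auto
  qed
  have qn: "q \<notin> nb v" "q \<notin> nb b" "r \<notin> nb v" "r \<notin> nb a" using nv na nb' d by auto
  have hq: "nb q \<inter> A = (if q = p1 then {a, p} else {a})"
    and hr: "nb r \<inter> A = (if r = p2 then {b, p} else {b})"
    using qn na nb' pp(1) qr d unfolding A_def by (auto simp: nb_Int_insert)
  have p1n: "p1 \<notin> nb v" "p1 \<notin> nb b" "p2 \<notin> nb v" "p2 \<notin> nb a" using nv na nb' ne pp qr by auto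
  have h1: "nb p1 \<inter> A = {p}" if "q \<noteq> p1" using that p1n na pp ne unfolding A_def
    by (auto simp: nb_Int_insert)
  have h2: "nb p2 \<inter> A = {p}" if "r \<noteq> p2" using that p1n nb' pp ne unfolding A_def
    by (auto simp: nb_Int_insert)
  have "dec U v = (\<Sum>u\<in>A. wt (white_deg U u)) - (\<Sum>u\<in>{p1, p2, q, r}. inc U A u)"
    by (intro dec_eq[OF UV]) (use U nv na nb' pp ne d in \<open>auto simp: N_def A_def\<close>)
  then have dec0: "dec U v = 24 - (\<Sum>u\<in>{p1, p2, q, r}. inc U A u)"
    using k3 k d by (simp add: A_def)
  have sum: "(\<Sum>u\<in>{p1, p2, q, r}. inc U A u) =
    (if q = p1 then inc U A q else inc U A p1 + inc U A q) + (if r = p2 then inc U A r else inc U A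
      p2 + inc U A r)"
    using d qr pp(4) by (simp add: sum.insert_if)
  have 1: "(if q = p1 then inc U A q else inc U A p1 + inc U A q) \<le> 3 - of_bool (E q)"
  proof (cases "q = p1")
    case True
    then show ?thesis using inc_double(1)[OF U(5) UV _ _ AU, of a p] hq d kp1 Ep by simp
  next
    case False
    then show ?thesis using inc_single(1)[OF U(5) UV _ AU, of a] inc_single(1)[OF pU(1) UV h1 AU] hq
      kp1 k E3[of q] by auto
  qed
  have 2: "(if r = p2 then inc U A r else inc U A p2 + inc U A r) \<le> 3 - of_bool (E r)"
  proof (cases "r = p2")
    case True
    then show ?thesis using inc_double(1)[OF U(6) UV _ _ AU, of b p] hr d kp2 Ep by simp
  next
    case False
    then show ?thesis using inc_single(1)[OF U(6) UV _ AU, of b] inc_single(1)[OF pU(2) UV h2 AU] hr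
      kp2 k E3[of r] by auto
  qed
  have dec: "dec U v \<ge> 18 + of_bool (E q) + of_bool (E r)" using dec0 sum 1 2 by linarith
  have "pair_saving U"
  proof (rule pair_savingI[OF r, of v])
    fix s x y assume "ear (U - N v) s x y"
    then have e: "ear (U - A) s x y" using N by simp
    have "E q \<or> E r" using H[OF e] e unfolding E_def by blast
    moreover have "white_deg (U - A) x + white_deg (U - A) y = 6 \<or> white_deg (U - A) x + white_deg
      (U - A) y = 5 \<and> E q \<and> E r"
      using ear_sum[OF UV e H] unfolding E_def .
    ultimately show "dec U v + int (white_deg (U - N v) x) + int (white_deg (U - N v) y) \<ge> 25"
      unfolding N using dec by (auto simp: of_bool_def split: if_splits)
  qed (use U UV dec in \<open>auto simp: N_def of_bool_def split: if_splits\<close>)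
  then show False using ng by blast
qed

lemma spread_3:
  assumes r: "reach U" and ng: "\<not> pair_saving U" and s: "spread U v a b p q r"
    and k: "white_deg U p = 3" "white_deg U q \<ge> 2" "white_deg U r \<ge> 2"
  shows False
proof -
  have d: "distinct [v, a, b, p, q, r]"
    and nv: "nb v = {a, b, p}" and na: "nb a = {v, b, q}" and nb': "nb b = {v, a, r}"
    using s by (auto simp: spread_def)
  have pab: "a \<notin> nb p" "b \<notin> nb p" using na nb' d nb_iff[of a p] nb_iff[of b p] by auto
  obtain p1 p2 where pp: "nb p = {v, p1, p2}" "v \<noteq> p1" "v \<noteq> p2" "p1 \<noteq> p2" "p1 \<in> nb p2" "p2 \<in> nb p1"
    "p1 \<noteq> p" "p2 \<noteq> p"
    by (rule outer_adj[OF nv pab]) (use d in auto)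
  have pp': "nb p = {v, p2, p1}" using pp(1) by blast
  show False
  \<comment> \<open>Coincidences across the two sides disappear when \<open>p1\<close> and
    \<open>p2\<close> exchange names, since \<open>q\<close> and \<open>r\<close> differ.\<close>
  proof (cases "q = p2 \<or> r = p1")
    case True
    then have "q \<noteq> p1" "r \<noteq> p2" using d pp by auto
    then show False using spread_3_aux[OF r ng s k pp' pp(3,2) pp(4)[symmetric] pp(6)] by blast
  next
    case False
    then show False using spread_3_aux[OF r ng s k pp(1-5)] by blast
  qed
qed

text \<open>By the symmetry of \<open>spread\<close> each outer neighbour can play the part of
  \<open>p\<close>. Either some outer white degree is 1, or all are 2, or one is 3 and the others
  are at least 2.\<close>

lemma white_deg_3_pair_saving:
  assumes r: "reach U" and v: "v \<in> U" "white_deg U v = 3"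
  shows "pair_saving U"
proof (rule ccontr)
  assume ng: "\<not> pair_saving U"
  have UV: "U \<subseteq> V" using r by (simp add: reach_def)
  obtain a b p q r' where s: "spread U v a b p q r'" using spread_exists[OF r ng v] .
  note s2 = spread_swap(1)[OF s] and s3 = spread_swap(1)[OF spread_swap(2)[OF s]]
  have b: "1 \<le> white_deg U u" "white_deg U u \<le> 3" if "u \<in> {p, q, r'}" for u
  proof -
    have "u \<in> U" "v \<in> nb p" "a \<in> nb q" "b \<in> nb r'" "v \<in> U" "a \<in> U" "b \<in> U"
      using s that nb_iff[of v p] nb_iff[of a q] nb_iff[of b r'] by (auto simp: spread_def)
    then show "1 \<le> white_deg U u" "white_deg U u \<le> 3" using that white_deg_pos white_deg_le_3 UV
      by auto
  qed
  have n1: "white_deg U p \<noteq> 1" "white_deg U q \<noteq> 1" "white_deg U r' \<noteq> 1"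
    using spread_1[OF r s] spread_1[OF r s2] spread_1[OF r s3] ng by auto
  show False
    using spread_2[OF r ng s] spread_3[OF r ng s] spread_3[OF r ng s2] spread_3[OF r ng s3]
      b[of p] b[of q] b[of r'] n1
    by fastforce
qed

section \<open>Positions of white degree at most two\<close>

text \<open>Blue stands for dominated. On a white cycle of length at least 4 this relation
  restricted to the edges of the cycle is a matching that covers all its vertices.\<close>

definition blue_pair :: "'a set \<Rightarrow> 'a \<Rightarrow> 'a \<Rightarrow> bool" where
  "blue_pair U x y \<longleftrightarrow> (\<exists>b. b \<notin> U \<and> nb b \<inter> U = {x, y})"

lemma blue_pair_sym: "blue_pair U x y \<Longrightarrow> blue_pair U y x"
  by (simp add: blue_pair_def insert_commute)

text \<open>A vertex of white degree 2 has exactly one dominated neighbour, which determines the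
  partner.\<close>

lemma blue_pair_unique:
  assumes x: "x \<in> U" "white_deg U x = 2" "U \<subseteq> V" and "blue_pair U x y" "blue_pair U x z"
  shows "y = z"
proof -
  obtain b c where b: "b \<notin> U" "nb b \<inter> U = {x, y}" and c: "c \<notin> U" "nb c \<inter> U = {x, z}"
    using assms unfolding blue_pair_def by blast
  have "b \<in> nb x" "c \<in> nb x" using b c nb_iff[of x b] nb_iff[of x c] by auto
  moreover have "card (nb x - U) = 1"
    using x card_nb[of x] card_Diff_subset_Int[of "nb x" U] by (auto simp: white_deg_def)
  ultimately have "b = c" using b(1) c(1) by (metis DiffI card_1_singletonE singletonD)
  then show ?thesis using b c by (auto simp: doubleton_eq_iff)
qed

text \<open>Claw-freeness at \<open>x\<close> makes the third neighbour \<open>b\<close>, which is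
  dominated, adjacent to \<open>p\<close> or \<open>q\<close>. By \<open>dominated_k\<close> it then
  has no other white neighbours.\<close>

lemma blue_pair_exists:
  assumes r: "reach U" and x: "x \<in> U" "nb x \<inter> U = {p, q}" "p \<noteq> q" "p \<notin> nb q"
  shows "blue_pair U x p \<or> blue_pair U x q"
proof -
  have UV: "U \<subseteq> V" using r by (simp add: reach_def)
  have pq: "p \<in> nb x" "q \<in> nb x" "p \<in> U" "q \<in> U" using x(2) by auto
  obtain b where b: "nb x = {p, q, b}" "p \<noteq> b" "q \<noteq> b" by (rule nbE2[OF pq(1,2) x(3)])
  have bU: "b \<notin> U" "b \<in> V" "x \<in> nb b" using b x nb_V[of b x] nb_iff[of x b] by auto
  have two: "nb b \<inter> U = {x, u}" if "u \<in> nb b" "u \<in> U" "u \<noteq> x" for u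
  proof -
    have "{x, u} = nb b \<inter> U"
    proof (rule card_seteq)
      show "card (nb b \<inter> U) \<le> card {x, u}" using dominated_k[OF r bU(2,1)] that
        by (simp add: white_deg_def)
    qed (use that bU x in auto)
    then show ?thesis by simp
  qed
  have "p \<in> nb b \<or> q \<in> nb b" using no_claw[of p x q b] b x(3,4) by auto
  moreover have "p \<noteq> x" "q \<noteq> x" using pq nb_irrefl[of x] by auto
  ultimately show ?thesis using two[of p] two[of q] pq bU unfolding blue_pair_def by blast
qed

text \<open>
  By claw-freeness the dominated neighbour of a vertex of a white cycle is shared with exactly one
    of
  its two neighbours on the cycle, so the cycle has a perfect matching.
\<close>
lemma no_white_pentagon:
  assumes r: "reach U" and "v \<in> U" "y \<in> U" "z \<in> U" "y' \<in> U" "z' \<in> U"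
    and n: "nb v \<inter> U = {y, z}" "nb y \<inter> U = {v, y'}" "nb z \<inter> U = {v, z'}"
      "nb y' \<inter> U = {y, z'}" "nb z' \<inter> U = {z, y'}"
    and d: "distinct [v, y, z, y', z']"
  shows False
proof -
  have UV: "U \<subseteq> V" using r by (simp add: reach_def)
  have k: "white_deg U u = 2" if "u \<in> {v, y, z, y', z'}" for u
    using that n d by (auto simp: white_deg_def)
  have na: "y \<notin> nb z" "v \<notin> nb y'" "v \<notin> nb z'" "y \<notin> nb z'" "z \<notin> nb y'"
  proof -
    have "y \<notin> nb z \<inter> U" "v \<notin> nb y' \<inter> U" "v \<notin> nb z' \<inter> U" "y \<notin> nb z' \<inter> U" "z \<notin> nb y' \<inter> U"
      unfolding n using d by auto
    then show "y \<notin> nb z" "v \<notin> nb y'" "v \<notin> nb z'" "y \<notin> nb z'" "z \<notin> nb y'" using assms(2-6) by auto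
  qed
  then have na': "y' \<notin> nb v" "z' \<notin> nb v" "z' \<notin> nb y" "y' \<notin> nb z"
    using nb_sym by blast+
  have e: "blue_pair U v y \<or> blue_pair U v z" "blue_pair U y v \<or> blue_pair U y y'"
    "blue_pair U z v \<or> blue_pair U z z'" "blue_pair U y' y \<or> blue_pair U y' z'"
    "blue_pair U z' z \<or> blue_pair U z' y'"
    using blue_pair_exists[OF r assms(2) n(1)] blue_pair_exists[OF r assms(3) n(2)]
      blue_pair_exists[OF r assms(4) n(3)] blue_pair_exists[OF r assms(5) n(4)]
      blue_pair_exists[OF r assms(6) n(5)] d na na' by auto
  have u: "p = q" if "blue_pair U x p" "blue_pair U x q" "x \<in> {v, y, z, y', z'}" for x p q
    using blue_pair_unique[OF _ k UV that(1,2)] that(3) assms(2-6) by blast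
  show False
    using e d blue_pair_sym u[of v] u[of y] u[of z] u[of y'] u[of z'] by simp metis
qed

text \<open>By \<open>ear_hit_k\<close> a new ear would need a tip of previous white degree 3, so
  after the move there is no ear and 18 suffices.\<close>

lemma low_pair_saving:
  assumes r: "reach U" and v: "v \<in> U" "dec U v \<ge> 18" and le: "\<And>x. x \<in> U \<Longrightarrow> white_deg U x \<le> 2"
    and no: "\<And>x y z. \<not> ear U x y z"
  shows "pair_saving U"
proof (rule pair_savingI[OF r _ _ v(2)])
  have UV: "U \<subseteq> V" using r by (simp add: reach_def)
  then show "v \<in> V" "N v \<inter> U \<noteq> {}" using v by (auto simp: N_def)
  fix x y z assume e: "ear (U - N v) x y z"
  have "N v \<inter> U \<subseteq> U" "U - N v = U - N v \<inter> U" by auto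
  then have "white_deg U x = 3" using ear_hit_k[OF UV no, of "N v \<inter> U"] e by simp
  moreover have "x \<in> U" using e by (simp add: ear_def)
  ultimately show "dec U v + int (white_deg (U - N v) y) + int (white_deg (U - N v) z) \<ge> 25"
    using le[of x] by simp
qed

text \<open>Playing the neighbour \<open>v\<close> of the path end \<open>u\<close> either removes a
  whole white edge, worth 18, or removes \<open>v\<close>, \<open>u\<close> and the next vertex
  \<open>z\<close>, worth at least 7 + 9 + 4.\<close>

lemma white_deg_1_pair_saving:
  assumes r: "reach U" and u: "u \<in> U" "white_deg U u = 1" and le: "\<And>x. x \<in> U \<Longrightarrow> white_deg U x \<le> 2"
    and no: "\<And>x y z. \<not> ear U x y z"
  shows "pair_saving U"
proof -
  have UV: "U \<subseteq> V" using r by (simp add: reach_def)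
  obtain v where v: "nb u \<inter> U = {v}" using u(2) by (rule white_deg_1E)
  then have v': "v \<in> U" "u \<in> nb v" "v \<noteq> u" using nb_iff[of u v] nb_irrefl[of u] by auto
  then have "white_deg U v = 1 \<or> white_deg U v = 2" using le[of v] white_deg_pos[of u v U] u
    by fastforce
  then show ?thesis
  proof
    assume k1: "white_deg U v = 1"
    then obtain w where "nb v \<inter> U = {w}" by (rule white_deg_1E)
    then have nv: "nb v \<inter> U = {u}" using v' u by auto
    have "dec U v = (\<Sum>x\<in>{v, u}. wt (white_deg U x)) - (\<Sum>x\<in>{}. inc U {v, u} x)"
      by (intro dec_eq[OF UV]) (use u v nv v' in \<open>auto simp: N_def\<close>)
    then have "dec U v \<ge> 18" using u k1 v' by simp
    then show ?thesis using low_pair_saving[OF r v'(1) _ le no] by blast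
  next
    assume k2: "white_deg U v = 2"
    then obtain y z where yz: "nb v \<inter> U = {y, z}" "y \<noteq> z" by (rule white_deg_2E)
    then have "u \<in> {y, z}" using v' u by auto
    then obtain z where z: "nb v \<inter> U = {u, z}" "u \<noteq> z" using yz by (cases "u = y") auto
    have z': "z \<in> U" "v \<in> nb z" "z \<in> V" "v \<noteq> z" using z nb_iff[of z v] nb_irrefl[of v] UV by auto
    define A where "A = {v, u, z}"
    have "wt (white_deg U z) - 3 * int (card (nb z \<inter> (U - A))) \<ge> (if white_deg U z \<le> 2 then 4 else
      0)"
      by (rule wt_partner[of v]) (use z' v' u A_def in auto)
    then have zb: "wt (white_deg U z) - 3 * int (card (nb z \<inter> (U - A))) \<ge> 4" using le z' by simp
    have "nb v \<inter> (U - A) = {}" "nb u \<inter> (U - A) = {}" using z v unfolding A_def by auto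
    moreover define f where "f x = wt (white_deg U x) - 3 * int (card (nb x \<inter> (U - A)))" for x
    ultimately have "f v = 7" "f u = 9" "f z \<ge> 4" using u k2 zb by simp_all
    then have "(\<Sum>x\<in>A. f x) \<ge> 20" using v' z z' unfolding A_def by simp
    moreover have "N v \<inter> U = A" using z v' unfolding A_def by (auto simp: N_def)
    ultimately have "dec U v \<ge> 20" using dec_lower[OF UV, of v A] unfolding f_def by simp
    then show ?thesis using low_pair_saving[OF r v'(1) _ le no] by simp
  qed
qed

text \<open>A move may be worth only 12, too little for \<open>pair_savingI\<close>, but every reply
  is worth 12 as well.\<close>

lemma white_deg_0_pair_saving:
  assumes r: "reach U" and v: "v \<in> U" and k0: "\<And>x. x \<in> U \<Longrightarrow> white_deg U x = 0"
  shows "pair_saving U"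
proof -
  have 12: "dec W w \<ge> 12" if "W \<subseteq> U" "N w \<inter> W \<noteq> {}" for W w
  proof -
    have WV: "W \<subseteq> V" using r that unfolding reach_def by blast
    have e: "nb x \<inter> W = {}" if "x \<in> W" for x
    proof -
      have "nb x \<inter> U = {}" using k0[of x] \<open>W \<subseteq> U\<close> that by (auto simp: white_deg_def)
      then show ?thesis using \<open>W \<subseteq> U\<close> by blast
    qed
    have "wt (white_deg W x) - 3 * int (card (nb x \<inter> (W - N w \<inter> W))) = 12" if "x \<in> N w \<inter> W" for x
    proof -
      have "nb x \<inter> W = {}" "nb x \<inter> (W - N w \<inter> W) = {}" using that e[of x] by blast+
      then show ?thesis by (simp add: white_deg_def)
    qed
    then have "dec W w \<ge> 12 * int (card (N w \<inter> W))" using dec_lower[OF WV, of w] by simp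
    moreover have "card (N w \<inter> W) \<ge> 1" using that(2) by (simp add: N_def Suc_le_eq card_gt_0_iff)
    ultimately show ?thesis by linarith
  qed
  have "v \<in> V" using v r by (auto simp: reach_def)
  moreover have "N v \<inter> U \<noteq> {}" using v by (auto simp: N_def)
  ultimately show ?thesis using 12[of U v] 12[of "U - N v"] unfolding pair_saving_def by fastforce
qed

text \<open>Playing a vertex of a white cycle yields 21 minus the gains of the next two vertices,
  that is 21 - 5 = 16 on a cycle of length 4 and 21 - 2 - 2 = 17 on longer ones. Both are below 18,
  so the replies have to be shown to be worth 8 and 7, respectively, instead of 6.\<close>

lemma cycle_pair_saving:
  assumes r: "reach U" and v: "v \<in> U"
    "white_deg U v = 2" and k02: "\<And>x. x \<in> U \<Longrightarrow> white_deg U x = 0 \<or> white_deg U x = 2"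
    and no: "\<And>x y z. \<not> ear U x y z"
  shows "pair_saving U"
proof -
  have UV: "U \<subseteq> V" using r by (simp add: reach_def)
  obtain y z where yz: "nb v \<inter> U = {y, z}" "y \<noteq> z" using v(2) by (rule white_deg_2E)
  have U: "y \<in> U" "z \<in> U" "v \<in> nb y" "v \<in> nb z" "v \<noteq> y" "v \<noteq> z"
    using yz nb_iff[of v y] nb_iff[of v z] nb_irrefl[of v] by auto
  have other: "\<exists>q. nb x \<inter> U = {p, q} \<and> p \<noteq> q \<and> q \<in> U \<and> x \<in> nb q" if "x \<in> U" "p \<in> nb x"
    "p \<in> U" for x p
  proof -
    have "white_deg U x = 2" using k02[OF that(1)] white_deg_pos[OF that(2,3)] by auto
    then obtain s t where st: "nb x \<inter> U = {s, t}" "s \<noteq> t" by (rule white_deg_2E)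
    moreover have "x \<in> nb s" "x \<in> nb t" using st nb_iff[of s x] nb_iff[of t x] by auto
    ultimately show ?thesis using that by (cases "p = s") auto
  qed
  obtain y' where y': "nb y \<inter> U = {v, y'}" "v \<noteq> y'" "y' \<in> U" "y \<in> nb y'" using other[of y v] U v
    by blast
  obtain z' where z': "nb z \<inter> U = {v, z'}" "v \<noteq> z'" "z' \<in> U" "z \<in> nb z'" using other[of z v] U v
    by blast
  have nyz: "y \<notin> nb z" using no[of v y z] yz v unfolding ear_def by blast
  have ne: "y' \<noteq> z" "z' \<noteq> y" "y \<noteq> y'" "z \<noteq> z'"
    using nyz y' z' nb_iff[of y z] nb_irrefl[of y] nb_irrefl[of z] by auto
  have k2: "white_deg U y = 2" "white_deg U z = 2" using y' z' by (auto simp: white_deg_def)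
  have k2': "white_deg U y' = 2" "white_deg U z' = 2"
    using k02[OF y'(3)] k02[OF z'(3)] white_deg_pos[OF y'(4) U(1)] white_deg_pos[OF z'(4) U(2)]
      by auto
  define A where "A = {v, y, z}"
  have A: "N v \<inter> U = A" using yz v unfolding A_def by (auto simp: N_def)
  have AU: "A \<subseteq> U" using v U A_def by auto
  define W where "W = U - A"
  have NW: "U - N v = W" using A W_def by auto
  have rW: "reach W" using reach_diff[OF r, of v] v UV NW by auto
  have vn: "y' \<notin> nb v" "z' \<notin> nb v" using yz y' z' ne by auto
  have hit: "x \<in> {y', z'}" if "x \<in> W" "nb x \<inter> A \<noteq> {}" for x
  proof -
    have "x \<in> nb v \<or> x \<in> nb y \<or> x \<in> nb z" using that(2) nb_iff[of x] unfolding A_def by blast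
    then show ?thesis using that(1) yz y' z' unfolding W_def A_def by auto
  qed
  have kW: "white_deg W x = white_deg U x" if "x \<in> W" "x \<notin> {y', z'}" for x
  proof -
    have "nb x \<inter> W = nb x \<inter> U" using hit[OF that(1)] that(2) W_def by auto
    then show ?thesis by (simp add: white_deg_def)
  qed
  have kWle: "white_deg W x \<le> 2" if "x \<in> W" for x
  proof -
    have "white_deg W x \<le> white_deg U x" unfolding white_deg_def W_def by (rule card_mono) auto
    then show ?thesis using k02[of x] that W_def by auto
  qed
  have noW: "\<not> ear W x p q" for x p q
  proof
    assume e: "ear W x p q"
    then have "white_deg U x = 3" using ear_hit_k[OF UV no _ AU] W_def by blast
    moreover have "x \<in> U" using e W_def by (auto simp: ear_def)
    ultimately show False using k02[of x] by simp
  qed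
  have "\<exists>d\<ge>16. dec U v = d \<and> (\<forall>w\<in>V. N w \<inter> W \<noteq> {} \<longrightarrow> d + dec W w \<ge> 24)"
  proof (cases "y' = z'")
    case True
    have "nb y' \<inter> A = {y, z}" using vn y' z' True unfolding A_def by (auto simp: nb_Int_insert)
    then have i: "inc U A y' = 5" using inc_double(1)[OF y'(3) UV _ yz(2) AU] k2' by simp
    have "dec U v = (\<Sum>u\<in>A. wt (white_deg U u)) - (\<Sum>u\<in>{y'}. inc U A u)"
      by (intro dec_eq[OF UV A]) (use yz y' z' ne True in \<open>auto simp: A_def\<close>)
    then have d: "dec U v = 16" using i v k2 U yz by (simp add: A_def)
    have "nb y' \<inter> U = {y, z}"
    proof -
      have "{y, z} = nb y' \<inter> U"
        by (rule card_subset_eq) (use y' z' True U yz(2) k2' in \<open>auto simp: white_deg_def\<close>)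
      then show ?thesis by simp
    qed
    then have "white_deg W y' = 0" unfolding W_def A_def white_deg_def by auto
    have k02W: "white_deg W x = 0 \<or> white_deg W x = 2" if "x \<in> W" for x
    proof (cases "x = y'")
      case False
      then show ?thesis using kW[OF that] k02[of x] that True W_def by auto
    qed (use \<open>white_deg W y' = 0\<close> in simp)
    \<comment> \<open>The rest of the 4-cycle is an isolated vertex. Without white degrees 1 or 3
      and without ears, only the first case of \<open>staller_bound\<close> remains.\<close>
    have "dec W w \<ge> 8" if "w \<in> V" "N w \<inter> W \<noteq> {}" for w
    proof (rule staller_bound[OF rW that])
      show ?thesis if "x \<in> W" "nb x \<inter> W = {y}" for x y
        using k02W[OF that(1)] that(2) by (simp add: white_deg_def)
    qed (use kWle noW in \<open>auto dest: kWle\<close>)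
    then show ?thesis using d by auto
  next
    case False
    have "nb y' \<inter> A = {y}" "nb z' \<inter> A = {z}" using vn y' z' ne False unfolding A_def
      by (auto simp: nb_Int_insert)
    then have i: "inc U A y' = 2" "inc U A z' = 2"
      using inc_single(1)[OF y'(3) UV _ AU] inc_single(1)[OF z'(3) UV _ AU] k2' by auto
    have "dec U v = (\<Sum>u\<in>A. wt (white_deg U u)) - (\<Sum>u\<in>{y', z'}. inc U A u)"
      by (intro dec_eq[OF UV A]) (use yz y' z' ne in \<open>auto simp: A_def\<close>)
    then have d: "dec U v = 17" using i v k2 U yz False by (simp add: A_def)
    \<comment> \<open>A leaf reply is worth \<open>5 + white_deg W q\<close>, which is below 7 only
      if \<open>x\<close> and \<open>q\<close> are two adjacent leaves. These would be
      \<open>y'\<close> and \<open>z'\<close>, so the cycle would be a pentagon.\<close>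
    have leaf: "white_deg W q \<ge> 2" if "x \<in> W" "nb x \<inter> W = {q}" for x q
    proof (rule ccontr)
      assume "\<not> white_deg W q \<ge> 2"
      then have kq: "white_deg W q < 2" by simp
      have q: "q \<in> W" "x \<in> nb q" "q \<in> nb x" "x \<noteq> q" using that nb_iff[of x q] nb_irrefl[of x]
        by auto
      have "white_deg U x \<noteq> 0" "white_deg U q \<noteq> 0"
        using white_deg_pos[OF q(3), of U] white_deg_pos[OF q(2), of U] q that W_def by auto
      then have "white_deg U x = 2" "white_deg U q = 2" using k02[of x] k02[of q] q that W_def
        by auto
      moreover have "white_deg W x = 1" using that(2) by (simp add: white_deg_def)
      ultimately have "x \<in> {y', z'}" "q \<in> {y', z'}" using kW[of x] kW[of q] q that kq by auto
      then have yzadj: "y' \<in> nb z'" "z' \<in> nb y'" using q by auto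
      have "nb y' \<inter> U = {y, z'}" "nb z' \<inter> U = {z, y'}"
      proof -
        have "{y, z'} = nb y' \<inter> U" "{z, y'} = nb z' \<inter> U"
          by (rule card_subset_eq; use y' z' yzadj U ne k2' in \<open>auto simp: white_deg_def\<close>)+
        then show "nb y' \<inter> U = {y, z'}" "nb z' \<inter> U = {z, y'}" by auto
      qed
      then show False
        using no_white_pentagon[OF r v(1) U(1,2) y'(3) z'(3) yz(1) y'(1) z'(1)] U yz y' z' ne False
          by auto
    qed
    have "dec W w \<ge> 7" if "w \<in> V" "N w \<inter> W \<noteq> {}" for w
    proof (rule staller_bound[OF rW that])
      show ?thesis if "x \<in> W" "nb x \<inter> W = {q}" "dec W w = 5 + int (white_deg W q)" for x q
        using leaf[OF that(1,2)] that(3) by simp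
    qed (use kWle noW in \<open>auto dest: kWle\<close>)
    then show ?thesis using d by auto
  qed
  then show ?thesis unfolding pair_saving_def using v UV NW A AU A_def by blast
qed

section \<open>A suitable move in every position, and the range of the total weight\<close>

lemma dominator_pair_saving:
  assumes r: "reach U" and "U \<noteq> {}"
  shows "pair_saving U"
proof (rule ccontr)
  assume ng: "\<not> pair_saving U"
  have UV: "U \<subseteq> V" using r by (simp add: reach_def)
  have no: "\<not> ear U x y z" for x y z using ear_pair_saving[OF r] ng by blast
  have le: "white_deg U x \<le> 2" if "x \<in> U" for x
    using white_deg_3_pair_saving[OF r that] white_deg_le_3[of x U] that UV ng by fastforce
  have k02: "white_deg U x = 0 \<or> white_deg U x = 2" if "x \<in> U" for x
    using white_deg_1_pair_saving[OF r that _ le no] le[OF that] ng by fastforce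
  obtain v where "v \<in> U" using assms(2) by blast
  then show False using white_deg_0_pair_saving[OF r] cycle_pair_saving[OF r _ _ k02 no] k02 ng
    by blast
qed

lemma Phi_full: "Phi V = 6 * int (card V)"
proof -
  have "nb x \<inter> V = nb x" for x using nb_V by blast
  then have "white_deg V x = 3" if "x \<in> V" for x using card_nb[OF that] by (simp add: white_deg_def)
  then show ?thesis by (simp add: Phi_def)
qed

lemma Phi_nonneg: "Phi U \<ge> 0"
  unfolding Phi_def by (rule sum_nonneg) (use wt_ge_6 in \<open>meson dual_order.trans zero_le_numeral\<close>)

text \<open>Pays for a last move of Dominator that leaves no reply. A single white vertex weighs 12,
  and two or more weigh at least 6 each.\<close>

lemma Phi_ge_12:
  assumes "U \<subseteq> V" "U \<noteq> {}"
  shows "Phi U \<ge> 12"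
proof (cases "card U = 1")
  case True
  then obtain x where "U = {x}" by (rule card_1_singletonE)
  then show ?thesis using nb_irrefl[of x] by (simp add: Phi_def white_deg_def)
next
  case False
  moreover have "finite U" using assms fin finite_subset by blast
  ultimately have "card U \<ge> 2" using assms(2)
    by (metis One_nat_def Suc_leI card_gt_0_iff le_neq_implies_less numeral_2_eq_2)
  moreover have "(\<Sum>x\<in>U. 6) \<le> Phi U" unfolding Phi_def by (rule sum_mono) (rule wt_ge_6)
  ultimately show ?thesis by simp
qed

end

section \<open>The game\<close>

lemma moves_left_no_legal: "legal_moves G D = {} \<Longrightarrow> moves_left G p D = 0"
  by (cases p) (simp_all add: moves_left.simps)

lemma moves_left_Dominator_le:
  assumes "finite (verts G)" "v \<in> legal_moves G D"
  shows "moves_left G Dominator D \<le> 1 + moves_left G Staller (insert v D)"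
proof -
  have "finite (legal_moves G D)" using assms(1) by (simp add: legal_moves_def)
  then have "(MIN v \<in> legal_moves G D. moves_left G Staller (insert v D))
      \<le> moves_left G Staller (insert v D)"
    using assms(2) by (intro Min_le) auto
  then show ?thesis using assms by (auto simp: moves_left.simps(1)[of G D])
qed

lemma moves_left_Staller_le:
  assumes "finite (verts G)" "legal_moves G D \<noteq> {}"
    and "\<And>w. w \<in> legal_moves G D \<Longrightarrow> moves_left G Dominator (insert w D) \<le> m"
  shows "moves_left G Staller D \<le> 1 + m"
proof -
  have "finite (legal_moves G D)" using assms(1) by (simp add: legal_moves_def)
  then have "(MAX w \<in> legal_moves G D. moves_left G Dominator (insert w D)) \<le> m"
    using assms(2,3) by (intro Max.boundedI) auto
  then show ?thesis using assms(1,2) by (simp add: moves_left.simps(2)[of G D])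
qed

text \<open>Without parallel arcs the heads of the arcs leaving a vertex are distinct, so the
  out-degree counts neighbours. Three pairwise non-adjacent neighbours of \<open>x\<close> together
  with \<open>x\<close> induce a star, contrary to \<open>claw_free\<close>.\<close>

lemma claw_free_cubic_nbs_graph:
  assumes "graph G" "cubic G" "claw_free G"
  shows "claw_free_cubic_nbs (verts G) (\<lambda>v. {u. v \<rightarrow>\<^bsub>G\<^esub> u})"
proof -
  interpret graph G by fact
  show ?thesis
  proof
    show "finite (verts G)" by simp
    show "u \<in> verts G" if "u \<in> {u. v \<rightarrow>\<^bsub>G\<^esub> u}" for u v using that adj_in_verts(2) by simp
    show "v \<in> {w. u \<rightarrow>\<^bsub>G\<^esub> w}" if "u \<in> {u. v \<rightarrow>\<^bsub>G\<^esub> u}" for u v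
      using that arcs_ends_symmetric[OF sym_arcs] by simp
    show "v \<notin> {u. v \<rightarrow>\<^bsub>G\<^esub> u}" for v using adj_not_same by auto
    show "card {u. v \<rightarrow>\<^bsub>G\<^esub> u} = 3" if "v \<in> verts G" for v
    proof -
      have "inj_on (head G) (out_arcs G v)"
        using no_multi_arcs by (auto simp: inj_on_def arc_to_ends_def)
      then have "card (head G ` out_arcs G v) = out_degree G v"
        by (simp add: card_image out_degree_def)
      moreover have "head G ` out_arcs G v = {u. v \<rightarrow>\<^bsub>G\<^esub> u}"
        by (auto simp: arcs_ends_def arc_to_ends_def image_iff)
      ultimately show ?thesis using assms(2) that by (simp add: cubic_def)
    qed
    fix a b c x
    assume adj: "a \<in> {u. x \<rightarrow>\<^bsub>G\<^esub> u}" "b \<in> {u. x \<rightarrow>\<^bsub>G\<^esub> u}" "c \<in> {u. x \<rightarrow>\<^bsub>G\<^esub> u}"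
      and ne: "a \<noteq> b" "a \<noteq> c" "b \<noteq> c"
    show "a \<in> {u. b \<rightarrow>\<^bsub>G\<^esub> u} \<or> a \<in> {u. c \<rightarrow>\<^bsub>G\<^esub> u} \<or> b \<in> {u. c \<rightarrow>\<^bsub>G\<^esub> u}"
    proof (rule ccontr)
      assume "\<not> ?thesis"
      then have nadj: "\<not> b \<rightarrow>\<^bsub>G\<^esub> a" "\<not> c \<rightarrow>\<^bsub>G\<^esub> a" "\<not> c \<rightarrow>\<^bsub>G\<^esub> b" by auto
      have sym: "u \<rightarrow>\<^bsub>G\<^esub> w \<longleftrightarrow> w \<rightarrow>\<^bsub>G\<^esub> u" for u w using arcs_ends_symmetric[OF sym_arcs] by blast
      have loop: "\<not> u \<rightarrow>\<^bsub>G\<^esub> u" for u using adj_not_same by blast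
      define S where "S = {x, a, b, c}"
      have S: "S \<subseteq> verts G" using adj adj_in_verts by (auto simp: S_def)
      have ends: "arcs_ends (G \<restriction> S) = {(u, w). u \<rightarrow>\<^bsub>G\<^esub> w \<and> u \<in> S \<and> w \<in> S}"
        by (auto simp: arcs_ends_def arc_to_ends_def image_iff)
      also have "\<dots> = {x} \<times> {a, b, c} \<union> {a, b, c} \<times> {x}"
        using adj nadj sym loop unfolding S_def by blast
      finally have ends_eq: "arcs_ends (G \<restriction> S) = {x} \<times> {a, b, c} \<union> {a, b, c} \<times> {x}" .
      have graph_S: "graph (G \<restriction> S)"
      proof
        show "symmetric (G \<restriction> S)" unfolding symmetric_def ends_eq sym_def by auto
        show "finite (verts (G \<restriction> S))" using S finite_subset by (auto simp: S_def)
      qed (use no_loops no_multi_arcs in auto)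
      have "x \<notin> {a, b, c}" using adj loop by blast
      then have star: "verts (G \<restriction> S) = {x} \<union> {a, b, c} \<and> {x} \<inter> {a, b, c} = {} \<and> card {x} = 1 \<and> card
        {a, b, c} = 3
        \<and> arcs_ends (G \<restriction> S) = {x} \<times> {a, b, c} \<union> {a, b, c} \<times> {x}"
        using ne ends_eq by (simp add: S_def insert_commute)
      have "K\<^bsub>1,3\<^esub> (G \<restriction> S)"
        unfolding complete_bipartite_digraph_def
        by (intro conjI[OF graph_S] exI[of _ "{x}"] exI[of _ "{a, b, c}"]) (rule star)
      then show False using assms(3) induced_induce[OF S] unfolding claw_free_def by blast
    qed
  qed
qed

theorem theorem3p1:
  fixes G :: "('a, 'b) pre_digraph"
  assumes "graph G"
    and "verts G \<noteq> {}"
    and "cubic G"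
    and "claw_free G"
  shows "real (\<gamma>\<^sub>g G) \<le> real (card (verts G)) / 2"
proof -
  interpret claw_free_cubic_nbs "verts G" "\<lambda>v. {u. v \<rightarrow>\<^bsub>G\<^esub> u}"
    using assms by (intro claw_free_cubic_nbs_graph)
  define white where "white D = verts G - (\<Union>u\<in>D. N u)" for D
  have cn: "closed_neighborhood G v = N v" for v
    by (auto simp: closed_neighborhood_def N_def)
  have NV: "N v \<subseteq> verts G" if "v \<in> verts G" for v using that nb_V by (auto simp: N_def)
  have legal: "v \<in> legal_moves G D \<longleftrightarrow> v \<in> verts G \<and> N v \<inter> white D \<noteq> {}" for v D
    using NV by (auto simp: legal_moves_def cn white_def)
  have white_insert: "white (insert v D) = white D - N v" for v D by (auto simp: white_def)
  \<comment> \<open>The induction proceeds by whole rounds, so only positions with Dominator to move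
    are compared with their weight.\<close>
  have "12 * int (moves_left G Dominator D) \<le> Phi (white D)" if "reach (white D)" for D
    using that
  proof (induction "card (white D)" arbitrary: D rule: less_induct)
    case less
    show ?case
    proof (cases "white D = {}")
      case True
      then have "legal_moves G D = {}" using legal by blast
      then show ?thesis using Phi_nonneg by (simp add: moves_left_no_legal)
    next
      case False
      obtain v where v: "v \<in> verts G" "N v \<inter> white D \<noteq> {}"
        and dec: "\<And>w. w \<in> verts G \<Longrightarrow> N w \<inter> (white D - N v) \<noteq> {}
          \<Longrightarrow> dec (white D) v + dec (white D - N v) w \<ge> 24"
        using dominator_pair_saving[OF less.prems False] unfolding pair_saving_def by blast
      have mv: "moves_left G Dominator D \<le> 1 + moves_left G Staller (insert v D)"
        by (rule moves_left_Dominator_le[OF fin]) (use legal v in blast)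
      have fw: "finite (white D)" using fin by (simp add: white_def)
      show ?thesis
      proof (cases "legal_moves G (insert v D) = {}")
        case True
        then have "moves_left G Dominator D \<le> 1" using mv by (simp add: moves_left_no_legal)
        then show ?thesis using Phi_ge_12[OF _ False] by (simp add: white_def)
      next
        case ne: False
        \<comment> \<open>One bound for all replies of Staller. Rounding down loses nothing, because
          the number of remaining moves is an integer.\<close>
        define m where "m = nat ((Phi (white D) - 24) div 12)"
        have step: "moves_left G Dominator (insert w (insert v D)) \<le> m"
          if "w \<in> legal_moves G (insert v D)" for w
        proof -
          have w: "w \<in> verts G" "N w \<inter> (white D - N v) \<noteq> {}" using that legal white_insert by auto
          have wh: "white (insert w (insert v D)) = white D - N v - N w" by (simp add: white_insert)
          have "card (white D - N v - N w) < card (white D)"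
            by (rule psubset_card_mono[OF fw]) (use v in auto)
          moreover have "reach (white D - N v - N w)" using less.prems v w reach_diff by blast
          ultimately have "12 * int (moves_left G Dominator (insert w (insert v D))) \<le> Phi (white D
            - N v - N w)"
            using less.hyps[of "insert w (insert v D)"] wh by simp
          also have "\<dots> \<le> Phi (white D) - 24" using dec[OF w] by (simp add: dec_def)
          finally show ?thesis unfolding m_def by linarith
        qed
        obtain w where "w \<in> legal_moves G (insert v D)" using ne by blast
        then have w: "w \<in> verts G" "N w \<inter> (white D - N v) \<noteq> {}" using legal white_insert by auto
        \<comment> \<open>Ensures that \<open>nat\<close> does not truncate a negative value in
          \<open>m\<close>; it holds because a reply exists.\<close>
        have "Phi (white D) \<ge> 24" using dec[OF w] Phi_nonneg[of "white D - N v - N w"]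
          by (simp add: dec_def)
        then have "int m = (Phi (white D) - 24) div 12" unfolding m_def by simp
        moreover have "12 * ((Phi (white D) - 24) div 12) \<le> Phi (white D) - 24" by presburger
        ultimately have "12 * int (2 + m) \<le> Phi (white D)" by simp
        moreover have "moves_left G Dominator D \<le> 2 + m"
          using mv moves_left_Staller_le[OF fin ne step] by simp
        then have "12 * int (moves_left G Dominator D) \<le> 12 * int (2 + m)" by simp
        ultimately show ?thesis by simp
      qed
    qed
  qed
  moreover have "white {} = verts G" by (simp add: white_def)
  moreover have "reach (verts G)" by (simp add: reach_def)
  ultimately have "12 * int (moves_left G Dominator {}) \<le> 6 * int (card (verts G))"
    using Phi_full by metis
  then show ?thesis by (simp add: game_domination_number_def)
qed

end
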